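(* Let $(\mathcal F_0,\mathbf a)$ be initial data for the completion problem in $\mathbb C^d$, let $\lambda=\lambda(S_{\mathcal F_0})$, let $f:[0,\infty)\to[0,\infty)$ be a strictly convex function, and let $F:\mathbb R_{\ge0}^d\to\mathbb R$ be $F(\gamma)=\sum_{i=1}^d f(\gamma_i)$. Then there exists a vector $\mu=\mu(\lambda,\mathbf a,f)=\mu^\uparrow\in\Gamma_d(\mathbf a)$ such that: (1) $\mathcal F=(\mathcal F_0,\mathcal G)\in\mathcal C_{\mathbf a}(\mathcal F_0)$ is a global minimizer of $P_f$ on $\mathcal C_{\mathbf a}(\mathcal F_0)$ if and only if $\mathcal F\in\mathcal C_{\mathbf a}^{\rm op}(\mathcal F_0)$ and $\lambda^\uparrow(S_{\mathcal G})=\mu$. (2) $\mu$ is uniquely determined by the conditions $$\mu\in\Gamma_d(\mathbf a)\quad\text{and}\quad F(\lambda+\mu)=\min_{\gamma\in\Gamma_d(\mathbf a)}F(\lambda+\gamma)=\min_{\nu\in\Lambda_{\mathbf a}^{\rm op}(\lambda)}F(\nu).$$ (3) For every $1\le i\le d-1$: if $0<\mu_i=\mu_{i+1}$ then $\lambda_i=\lambda_{i+1}$.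
   Context: For a vector $x\in\mathbb R^m$, $x^\downarrow$ (resp. $x^\uparrow$) is its decreasing (resp. increasing) rearrangement. For a positive semidefinite $d\times d$ matrix $S$, $\lambda(S)\in\mathbb R_{\ge0}^d$ is the vector of eigenvalues (with multiplicity) in decreasing order, and $\lambda^\uparrow(S)$ the same in increasing order. $x\otimes y$ is the operator $z\mapsto\langle z,y\rangle x$. Majorization: $x\prec y$ means $\sum_{i\le j}x_i^\downarrow\le\sum_{i\le j}y_i^\downarrow$ for all $j$ with equality of total sums; if $x,y$ have different lengths the shorter is first padded with zeros. For a finite sequence $\mathcal F=\{f_i\}$ in $\mathbb C^d$, its frame operator is $S_{\mathcal F}=\sum_i f_i\otimes f_i$, and the convex potential of $f$ is $P_f(\mathcal F)=\operatorname{tr} f(S_{\mathcal F})=\sum_{i=1}^d f(\lambda_i(S_{\mathcal F}))$. Initial data for the completion problem is a pair $(\mathcal F_0,\mathbf a)$ with $\mathcal F_0=\{f_i\}_{i=1}^{n_0}$ a finite sequence in $\mathbb C^d$ and $\mathbf a=(\alpha_i)_{i=1}^k\in\mathbb R_{>0}^k$ such that $d-\operatorname{rk}S_{\mathcal F_0}\le k$; put $n=n_0+k$. $\mathcal C_{\mathbf a}(\mathcal F_0)$ is the set of sequences $\mathcal F=(\mathcal F_0,\mathcal G)=\{f_i\}_{i=1}^n$ whose first $n_0$ vectors are $\mathcal F_0$ and whose remaining vectors $\mathcal G=\{f_i\}_{i=n_0+1}^n$ satisfy $\|f_{n_0+i}\|^2=\alpha_i$ for $1\le i\le k$. Define $$\mathcal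 C_{\mathbf a}^{\rm op}(\mathcal F_0)=\{\mathcal F=(\mathcal F_0,\mathcal G)\in\mathcal C_{\mathbf a}(\mathcal F_0):\ \lambda(S_{\mathcal F})=(\lambda(S_{\mathcal F_0})+\lambda^\uparrow(S_{\mathcal G}))^\downarrow\},$$ $\Gamma_d(\mathbf a)=\{\mu\in\mathbb R_{\ge0}^d:\ \mu=\mu^\uparrow,\ \mathbf a\prec\mu\}$, and $\Lambda_{\mathbf a}^{\rm op}(\lambda)=\{\lambda^\downarrow+\mu:\ \mu\in\Gamma_d(\mathbf a)\}$. *)

theory Defs
  imports
    "Jordan_Normal_Form.Char_Poly"
    "Jordan_Normal_Form.DL_Rank"
    "HOL-Computational_Algebra.Fundamental_Theorem_Algebra"
begin

text \<open>
  Vectors and matrices are those of Jordan_Normal_Form, indexed from 0; finite sequences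
  of vectors of complex \<open>d\<close>-space are lists, and \<open>(F0, G)\<close> is \<open>F0 @ G\<close>.
\<close>

definition dec_rearr :: "real vec \<Rightarrow> real vec" where
  "dec_rearr x = vec_of_list (rev (sort (list_of_vec x)))"

definition inc_rearr :: "real vec \<Rightarrow> real vec" where
  "inc_rearr x = vec_of_list (sort (list_of_vec x))"

definition zero_pad :: "nat \<Rightarrow> real vec \<Rightarrow> real vec" where
  "zero_pad m x = vec m (\<lambda>i. if i < dim_vec x then x $ i else 0)"

definition majorized_by :: "real vec \<Rightarrow> real vec \<Rightarrow> bool" where
  "majorized_by x y \<longleftrightarrow>
    (let m = max (dim_vec x) (dim_vec y);
         x' = dec_rearr (zero_pad m x);
         y' = dec_rearr (zero_pad m y)
     in (\<forall>j\<le>m. (\<Sum>i<j. x' $ i) \<le> (\<Sum>i<j. y' $ i)) \<and>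
        (\<Sum>i<m. x' $ i) = (\<Sum>i<m. y' $ i))"

text \<open>
  The eigenvalues of a matrix are the roots of its characteristic polynomial, counted with
  algebraic multiplicity.  The next definition is only meant for Hermitian matrices, for which
  \<open>Re\<close> discards nothing and algebraic and geometric multiplicities agree.
\<close>

definition eigs_dec :: "complex mat \<Rightarrow> real vec" where
  "eigs_dec S = vec_of_list (rev (sorted_list_of_multiset (image_mset Re (proots (char_poly S)))))"

definition eigs_inc :: "complex mat \<Rightarrow> real vec" where
  "eigs_inc S = inc_rearr (eigs_dec S)"

definition rank_one :: "complex vec \<Rightarrow> complex vec \<Rightarrow> complex mat" where
  "rank_one x y = mat (dim_vec x) (dim_vec y) (\<lambda>(i, j). x $ i * conjugate (y $ j))"

lemma rank_one_mult_vec: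
  assumes "z \<in> carrier_vec (dim_vec y)"
  shows "rank_one x y *\<^sub>v z = (z \<bullet>c y) \<cdot>\<^sub>v x"
  using assms
  by (intro eq_vecI)
     (auto simp: rank_one_def scalar_prod_def sum_distrib_left mult.commute mult.left_commute
           intro!: sum.cong)

definition frame_op :: "nat \<Rightarrow> complex vec list \<Rightarrow> complex mat" where
  "frame_op d F = foldr (\<lambda>g S. rank_one g g + S) F (0\<^sub>m d d)"

definition sq_norm :: "complex vec \<Rightarrow> real" where
  "sq_norm v = Re (v \<bullet>c v)"

definition sum_fun :: "nat \<Rightarrow> (real \<Rightarrow> real) \<Rightarrow> real vec \<Rightarrow> real" where
  "sum_fun d f x = (\<Sum>i<d. f (x $ i))"

definition convex_potential :: "nat \<Rightarrow> (real \<Rightarrow> real) \<Rightarrow> complex vec list \<Rightarrow> real" where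
  "convex_potential d f F = sum_fun d f (eigs_dec (frame_op d F))"

definition initial_data :: "nat \<Rightarrow> complex vec list \<Rightarrow> real vec \<Rightarrow> bool" where
  "initial_data d F0 a \<longleftrightarrow>
    set F0 \<subseteq> carrier_vec d \<and>
    (\<forall>i<dim_vec a. 0 < a $ i) \<and>
    d - vec_space.rank d (frame_op d F0) \<le> dim_vec a"

definition completions :: "nat \<Rightarrow> complex vec list \<Rightarrow> real vec \<Rightarrow> complex vec list set" where
  "completions d F0 a =
    {F0 @ G | G. set G \<subseteq> carrier_vec d \<and> length G = dim_vec a \<and>
                 (\<forall>i<dim_vec a. sq_norm (G ! i) = a $ i)}"

definition completions_op :: "nat \<Rightarrow> complex vec list \<Rightarrow> real vec \<Rightarrow> complex vec list set" where
  "completions_op d F0 a =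
    {F0 @ G | G. F0 @ G \<in> completions d F0 a \<and>
                 eigs_dec (frame_op d (F0 @ G)) =
                   dec_rearr (eigs_dec (frame_op d F0) + eigs_inc (frame_op d G))}"

definition Gamma_set :: "nat \<Rightarrow> real vec \<Rightarrow> real vec set" where
  "Gamma_set d a =
    {\<mu> \<in> carrier_vec d. (\<forall>i<d. 0 \<le> \<mu> $ i) \<and> \<mu> = inc_rearr \<mu> \<and> majorized_by a \<mu>}"

definition Lambda_op :: "nat \<Rightarrow> real vec \<Rightarrow> real vec \<Rightarrow> real vec set" where
  "Lambda_op d a l = {dec_rearr l + \<mu> | \<mu>. \<mu> \<in> Gamma_set d a}"

definition strictly_convex_nonneg :: "(real \<Rightarrow> real) \<Rightarrow> bool" where
  "strictly_convex_nonneg f \<longleftrightarrow>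
    (\<forall>x\<ge>0. \<forall>y\<ge>0. \<forall>t. x \<noteq> y \<and> 0 < t \<and> t < 1 \<longrightarrow>
       f ((1 - t) * x + t * y) < (1 - t) * f x + t * f y)"

definition is_minimum_of :: "real \<Rightarrow> real set \<Rightarrow> bool" where
  "is_minimum_of c A \<longleftrightarrow> c \<in> A \<and> (\<forall>x\<in>A. c \<le> x)"

end

theory Submission
  imports
    Defs
    "Jordan_Normal_Form.Schur_Decomposition"
    "HOL-Combinatorics.Permutations"
begin

text \<open>
  Write \<open>\<lambda>\<close> for the decreasing spectrum of the given frame and \<open>F(x)\<close> for the sum of the values of \<open>f\<close>
  at the entries of \<open>x\<close>. The problem for completions reduces to a finite-dimensional convex one by two
  facts about matrices.

  Lidskii's inequality (\<open>lidskii\<close>) says that adding the spectrum of the new vectors to \<open>\<lambda>\<close> in the opposite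
  order gives a vector majorized by the spectrum of the completed frame. Hence a completion with new
  spectrum \<open>\<nu>\<close>, arranged increasingly, has potential at least \<open>F(\<lambda> + \<nu>)\<close>, with equality exactly for the
  completions in \<open>completions_op\<close> (\<open>convex_potential_lower_bound\<close>).

  The Schur--Horn theorem for frames says that the spectra \<open>\<nu>\<close> that occur are exactly the elements of
  \<open>Gamma_set d a\<close> (\<open>spectrum_in_Gamma_set\<close>, \<open>exists_frame_with_spectrum\<close>). The eigenvectors can be
  prescribed as well; with those of the given frame the lower bound \<open>F(\<lambda> + \<nu>)\<close> is attained.

  So the optimal completions are those in \<open>completions_op\<close> whose new spectrum minimizes \<open>F(\<lambda> + \<mu>)\<close>
  over \<open>\<mu>\<close> in \<open>Gamma_set d a\<close>, which is a compact convex polytope. Strict convexity makes the minimizer unique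
  (\<open>feasible_minimizer_unique\<close>), and its existence follows from compactness once \<open>f\<close>, which may jump
  at 0, is made lower semicontinuous there (\<open>lsc_regularization\<close>). This change does no harm because the assumption on
  the rank forces all entries of \<open>\<lambda> + \<mu>\<close> to be positive at the minimum (\<open>minimizer_positive\<close>). Finally, if
  \<open>\<lambda>\<close> were to decrease strictly inside a block of equal positive entries of \<open>\<mu>\<close>, spreading that block
  would improve the value (\<open>minimizer_blocks\<close>).

  Majorization enters through \<open>averaging\<close>: \<open>x\<close> is majorized by \<open>y\<close> if finitely many moves, each of which brings
  two entries closer at constant sum, lead from \<open>y\<close> to \<open>x\<close>. Such a move decreases sums of strictly convex
  functions, and on the squared norms of a frame it can be carried out by rotating two vectors,
  which preserves the frame operator.
\<close>

section \<open>Majorization as repeated averaging\<close>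

text \<open>
  One step replaces two entries \<open>u\<close> and \<open>v\<close> by two entries with the same sum that lie between them. This
  is the working form of majorization: \<open>averaging M N\<close> holds when \<open>N\<close> is majorized by \<open>M\<close>, and any
  claim about majorized vectors reduces to a claim about two entries.
\<close>

inductive averaging :: "real multiset \<Rightarrow> real multiset \<Rightarrow> bool" where
  averaging_refl: "averaging M M"
| averaging_step: "averaging M (add_mset u (add_mset v N)) \<Longrightarrow> v \<le> u' \<Longrightarrow> u' \<le> u \<Longrightarrow>
    averaging M (add_mset u' (add_mset (u + v - u') N))"

lemma averaging_trans:
  assumes "averaging M N" "averaging L M"
  shows "averaging L N"
  using assms by (induction rule: averaging.induct) (auto intro: averaging.intros)

lemma averaging_add_mset:
  assumes "averaging M N"
  shows "averaging (add_mset a M) (add_mset a N)"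
  using assms
proof (induction rule: averaging.induct)
  case (averaging_step M u v N u')
  then have "averaging (add_mset a M) (add_mset u (add_mset v (add_mset a N)))"
    by (simp add: add_mset_commute)
  from averaging.averaging_step[OF this averaging_step(2,3)] show ?case
    by (simp add: add_mset_commute)
qed (rule averaging_refl)

text \<open>
  Both lists are meant to be sorted decreasingly, so that the prefix sums are the sums of the largest
  entries.
\<close>

definition list_majorized :: "real list \<Rightarrow> real list \<Rightarrow> bool" where
  "list_majorized xs ys \<longleftrightarrow> length xs = length ys \<and> sum_list xs = sum_list ys \<and>
     (\<forall>j. sum_list (take j xs) \<le> sum_list (take j ys))"

lemma adjacent_crossing:
  fixes a :: real
  assumes "a \<le> y" "last (z # ys) \<le> a"
  shows "\<exists>ps u v qs. y # z # ys = ps @ u # v # qs \<and> v \<le> a \<and> a \<le> u"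
  using assms
proof (induction ys arbitrary: y z)
  case Nil
  then show ?case by (metis append_Nil last_ConsL)
next
  case (Cons w ys)
  show ?case
  proof (cases "z \<le> a")
    case True
    then have "y # z # w # ys = [] @ y # z # w # ys \<and> z \<le> a \<and> a \<le> y" using Cons.prems by simp
    then show ?thesis by blast
  next
    case False
    then have "\<exists>ps u v qs. z # w # ys = ps @ u # v # qs \<and> v \<le> a \<and> a \<le> u"
      using Cons.IH[of z w] Cons.prems by auto
    then show ?thesis by (metis append_Cons)
  qed
qed

text \<open>
  The last entry of a decreasing list is at most the mean.
\<close>

lemma sum_list_ge_last:
  fixes xs :: "real list"
  assumes "sorted_wrt (\<ge>) xs" "xs \<noteq> []"
  shows "length xs * last xs \<le> sum_list xs"
proof -
  have "last xs \<le> x" if "x \<in> set xs" for x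
    using assms that by (cases xs rule: rev_cases) (auto simp: sorted_wrt_append)
  then have "(\<Sum>x\<leftarrow>xs. last xs) \<le> (\<Sum>x\<leftarrow>xs. x)"
    by (intro sum_list_mono)
  then show ?thesis by (simp add: sum_list_triv)
qed

lemma sum_list_take_le_hd:
  fixes a :: real
  assumes "sorted_wrt (\<ge>) (a # xs)"
  shows "sum_list (take j xs) \<le> real (min j (length xs)) * a"
proof -
  have "(\<Sum>x\<leftarrow>take j xs. x) \<le> (\<Sum>x\<leftarrow>take j xs. a)"
    using assms by (intro sum_list_mono) (auto dest: in_set_takeD)
  then show ?thesis by (simp add: sum_list_triv min.commute)
qed

text \<open>
  Induction on the majorized list, following Horn. Its largest entry \<open>a\<close> lies below the first entry of
  \<open>ys\<close> and above the last one, hence between two neighbours \<open>u\<close> and \<open>v\<close> in \<open>ys\<close>. One step turns this pair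
  into \<open>a\<close> and \<open>w = u + v - a\<close>. Because \<open>u\<close> and \<open>v\<close> are neighbours, \<open>w\<close> can take their place without
  breaking the order, and removing \<open>a\<close> on both sides preserves majorization.
\<close>

theorem averaging_if_list_majorized:
  assumes "sorted_wrt (\<ge>) xs" "sorted_wrt (\<ge>) ys" "list_majorized xs ys"
  shows "averaging (mset ys) (mset xs)"
  using assms
proof (induction xs arbitrary: ys)
  case Nil
  then show ?case by (auto simp: list_majorized_def intro: averaging_refl)
next
  case (Cons a xs)
  note len = Cons.prems(3)[unfolded list_majorized_def]
  show ?case
  proof (cases xs)
    case Nil
    then have "ys = [a]" using len by (cases ys) auto
    with Nil show ?thesis by (simp add: averaging_refl)
  next
    case (Cons b zs)
    then obtain y z ws where ys: "ys = y # z # ws"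
      using len by (cases ys; cases "tl ys") auto
    have "a \<le> y" using len[THEN conjunct2, THEN conjunct2, rule_format, of 1] by (simp add: ys)
    moreover have "last (z # ws) \<le> a"
    proof -
      have "real (length ys) * last ys \<le> sum_list (a # xs)"
        using sum_list_ge_last[OF Cons.prems(2)] len by (auto simp: ys)
      also have "\<dots> \<le> real (length ys) * a"
        using sum_list_take_le_hd[OF Cons.prems(1), of "length xs"] len
        by (auto simp: algebra_simps simp flip: len)
      finally show ?thesis by (simp add: ys mult_le_cancel_left)
    qed
    ultimately obtain ps u v qs where dec: "ys = ps @ u # v # qs" "v \<le> a" "a \<le> u"
      using adjacent_crossing[of a y z ws] unfolding ys by blast
    define w where "w = u + v - a"
    define ys' where "ys' = ps @ w # qs"
    have w: "v \<le> w" "w \<le> u" using dec by (auto simp: w_def)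
    have sorted: "sorted_wrt (\<ge>) ys'"
      using Cons.prems(2) w unfolding dec(1) ys'_def
      by (fastforce simp: sorted_wrt_append)
    have prefix: "sum_list (take j xs) \<le> sum_list (take j ys')" for j
    proof (cases "j \<le> length ps")
      case True
      have "sum_list (take j xs) \<le> real (min j (length xs)) * a"
        by (rule sum_list_take_le_hd[OF Cons.prems(1)])
      also have "\<dots> = real (length (take j ps)) * a"
        using True len by (simp add: dec(1) min_def)
      also have "\<dots> = (\<Sum>x\<leftarrow>take j ps. a)" by (simp add: sum_list_triv)
      also have "\<dots> \<le> (\<Sum>x\<leftarrow>take j ps. x)"
        using Cons.prems(2) dec(3) unfolding dec(1)
        by (intro sum_list_mono) (auto simp: sorted_wrt_append dest!: in_set_takeD)
      finally show ?thesis using True by (simp add: ys'_def)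
    next
      case False
      then obtain i where j: "j = Suc (length ps + i)"
        by (metis add_Suc_right less_imp_Suc_add not_le)
      have "a + sum_list (take j xs) \<le> sum_list (take (Suc j) ys)"
        using len[THEN conjunct2, THEN conjunct2, rule_format, of "Suc j"] by simp
      also have "\<dots> = a + sum_list (take j ys')"
        by (simp add: j dec(1) ys'_def w_def)
      finally show ?thesis by simp
    qed
    have "averaging (mset ys') (mset xs)"
      using len prefix sorted Cons.prems(1)
      by (intro Cons.IH) (auto simp: list_majorized_def ys'_def dec(1) w_def)
    from averaging_add_mset[OF this]
    have "averaging (add_mset a (mset ys')) (mset (a # xs))" by simp
    moreover have "averaging (mset ys) (add_mset a (mset ys'))"
      using averaging_step[of "mset ys" u v "mset ps + mset qs" a] dec
      by (simp add: ys'_def w_def averaging_refl)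
    ultimately show ?thesis by (rule averaging_trans[rotated, rotated])
  qed
qed

text \<open>
  Both new points are convex combinations of \<open>u\<close> and \<open>v\<close> with exchanged weights.
\<close>

lemma strict_convex_transfer:
  assumes f: "strictly_convex_nonneg f" and "0 \<le> v" "v < u'" "u' < u"
  shows "f u' + f (u + v - u') < f u + f v"
proof -
  define t where "t = (u' - v) / (u - v)"
  have t: "0 < t" "t < 1" using assms by (auto simp: t_def field_simps)
  have "t * (u - v) = u' - v" using assms by (simp add: t_def)
  then have eqs: "u' = (1 - t) * v + t * u" "u + v - u' = (1 - t) * u + t * v"
    by (auto simp: algebra_simps)
  have "f u' < (1 - t) * f v + t * f u"
    using f t assms(2-) unfolding strictly_convex_nonneg_def eqs(1) by simp
  moreover have "f (u + v - u') < (1 - t) * f u + t * f v"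
    using f t assms(2-) unfolding strictly_convex_nonneg_def eqs(2) by simp
  ultimately show ?thesis by (simp add: algebra_simps)
qed

text \<open>
  The inequality of Karamata with its equality case: a step that moves anything at all strictly
  decreases the sum, so equality forces every step to be trivial.
\<close>

theorem averaging_strict_convex:
  assumes "averaging M N" "strictly_convex_nonneg f" "\<forall>x\<in>#M. 0 \<le> x"
  shows "(\<forall>x\<in>#N. 0 \<le> x) \<and> (N = M \<or> (\<Sum>x\<in>#N. f x) < (\<Sum>x\<in>#M. f x))"
  using assms
proof (induction rule: averaging.induct)
  case (averaging_step M u v N u')
  consider "u' = u" | "u' = v" | "v < u'" "u' < u" using averaging_step.hyps by linarith
  then show ?case
  proof cases
    case 3
    with strict_convex_transfer[OF averaging_step.prems(1), of v u' u] show ?thesis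
      using averaging_step by force
  qed (use averaging_step in \<open>auto simp: add_mset_commute\<close>)
qed auto

section \<open>Hermitian matrices\<close>

lemma cscalar_prod_sum:
  assumes "x \<in> carrier_vec d" "y \<in> carrier_vec d"
  shows "x \<bullet>c y = (\<Sum>i<d. x $ i * cnj (y $ i))"
  using assms by (auto simp: scalar_prod_def lessThan_atLeast0)

lemma cscalar_prod_commute:
  assumes "x \<in> carrier_vec d" "y \<in> carrier_vec d"
  shows "y \<bullet>c x = cnj (x \<bullet>c y)"
  using assms by (simp add: cscalar_prod_sum mult.commute)

lemma mult_mat_vec_sum:
  assumes "A \<in> carrier_mat d d" "x \<in> carrier_vec d" "i < d"
  shows "(A *\<^sub>v x) $ i = (\<Sum>j<d. A $$ (i, j) * x $ j)"
  using assms by (auto simp: scalar_prod_def lessThan_atLeast0)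

lemma sq_norm_sum:
  assumes "x \<in> carrier_vec d"
  shows "sq_norm x = (\<Sum>i<d. (cmod (x $ i))\<^sup>2)"
  using assms by (simp add: sq_norm_def cscalar_prod_sum complex_norm_square[symmetric] Re_sum
      flip: of_real_power)

lemma cscalar_prod_self:
  assumes "x \<in> carrier_vec d"
  shows "x \<bullet>c x = complex_of_real (sq_norm x)"
  using assms by (simp add: sq_norm_sum cscalar_prod_sum complex_norm_square[symmetric])

lemma sq_norm_nonneg: "x \<in> carrier_vec d \<Longrightarrow> 0 \<le> sq_norm x"
  by (simp add: sq_norm_sum sum_nonneg)

lemma sq_norm_eq_0:
  assumes "x \<in> carrier_vec d" "sq_norm x = 0"
  shows "x = 0\<^sub>v d"
  using assms by (intro eq_vecI) (auto simp: sq_norm_sum sum_nonneg_eq_0_iff)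

lemma sq_norm_smult: "x \<in> carrier_vec d \<Longrightarrow> sq_norm (c \<cdot>\<^sub>v x) = (cmod c)\<^sup>2 * sq_norm x"
  by (simp add: sq_norm_sum[of _ d] norm_mult power_mult_distrib sum_distrib_left)

definition hermitian :: "nat \<Rightarrow> complex mat \<Rightarrow> bool" where
  "hermitian d A \<longleftrightarrow> A \<in> carrier_mat d d \<and> (\<forall>i<d. \<forall>j<d. A $$ (i, j) = cnj (A $$ (j, i)))"

definition qform :: "complex mat \<Rightarrow> complex vec \<Rightarrow> real" where
  "qform A x = Re ((A *\<^sub>v x) \<bullet>c x)"

definition trace :: "complex mat \<Rightarrow> complex" where
  "trace A = (\<Sum>i<dim_row A. A $$ (i, i))"

lemma hermitian_adjoint:
  assumes "hermitian d A" "x \<in> carrier_vec d" "y \<in> carrier_vec d"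
  shows "(A *\<^sub>v x) \<bullet>c y = x \<bullet>c (A *\<^sub>v y)"
proof -
  have A: "A \<in> carrier_mat d d" "\<And>i j. i < d \<Longrightarrow> j < d \<Longrightarrow> A $$ (i, j) = cnj (A $$ (j, i))"
    using assms(1) unfolding hermitian_def by blast+
  have "(A *\<^sub>v x) \<bullet>c y = (\<Sum>i<d. \<Sum>j<d. A $$ (i, j) * x $ j * cnj (y $ i))"
    using A(1) assms(2,3) by (subst cscalar_prod_sum[of _ d]) (auto simp: mult_mat_vec_sum sum_distrib_right
      simp del: index_mult_mat_vec intro!: sum.cong)
  also have "\<dots> = (\<Sum>j<d. \<Sum>i<d. A $$ (i, j) * x $ j * cnj (y $ i))"
    by (rule sum.swap)
  also have "\<dots> = (\<Sum>j<d. \<Sum>i<d. x $ j * cnj (A $$ (j, i) * y $ i))"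
  proof (intro sum.cong[OF refl])
    fix i j assume "j \<in> {..<d}" "i \<in> {..<d}"
    then have "A $$ (i, j) = cnj (A $$ (j, i))" using A by blast
    then show "A $$ (i, j) * x $ j * cnj (y $ i) = x $ j * cnj (A $$ (j, i) * y $ i)" by simp
  qed
  also have "\<dots> = x \<bullet>c (A *\<^sub>v y)"
    using A(1) assms(2,3) by (subst cscalar_prod_sum[of _ d]) (auto simp: mult_mat_vec_sum sum_distrib_left
      simp del: index_mult_mat_vec intro!: sum.cong)
  finally show ?thesis .
qed

lemma qform_add:
  assumes "A \<in> carrier_mat d d" "B \<in> carrier_mat d d" "x \<in> carrier_vec d"
  shows "qform (A + B) x = qform A x + qform B x"
  using assms by (simp add: qform_def add_mult_distrib_mat_vec add_scalar_prod_distrib[of _ d])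

lemma trace_add: "A \<in> carrier_mat d d \<Longrightarrow> B \<in> carrier_mat d d \<Longrightarrow> trace (A + B) = trace A + trace B"
  by (simp add: trace_def sum.distrib)

lemma trace_mult_commute:
  assumes "A \<in> carrier_mat d d" "B \<in> carrier_mat d d"
  shows "trace (A * B) = trace (B * A)"
proof -
  have "trace (A * B) = (\<Sum>i<d. \<Sum>j<d. A $$ (i, j) * B $$ (j, i))"
    using assms by (simp add: trace_def scalar_prod_def lessThan_atLeast0)
  also have "\<dots> = (\<Sum>j<d. \<Sum>i<d. B $$ (j, i) * A $$ (i, j))"
    by (subst sum.swap) (simp add: mult.commute)
  also have "\<dots> = trace (B * A)"
    using assms by (simp add: trace_def scalar_prod_def lessThan_atLeast0)
  finally show ?thesis .
qed

lemma trace_similar: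
  assumes "A \<in> carrier_mat d d" "similar_mat A B"
  shows "trace A = trace B"
proof -
  obtain P Q where w: "similar_mat_wit A B P Q" using assms(2) by (auto simp: similar_mat_def)
  note w = similar_mat_witD2[OF assms(1) w]
  have "trace A = trace ((P * B) * Q)" using w by simp
  also have "\<dots> = trace (Q * (P * B))"
    using w by (intro trace_mult_commute[of _ d]) auto
  also have "Q * (P * B) = B" using w by (simp flip: assoc_mult_mat[of Q d d P d B d])
  finally show ?thesis .
qed

text \<open>
  If \<open>c\<close> were the only eigenvalue, a triangular form of the matrix would have \<open>c\<close> everywhere on the diagonal,
  which fixes the trace.
\<close>

lemma exists_other_eigenvalue:
  assumes A: "A \<in> carrier_mat d d" and tr: "trace A \<noteq> of_nat d * c"
  shows "\<exists>e. e \<noteq> c \<and> eigenvalue A e"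
proof (rule ccontr)
  assume none: "\<nexists>e. e \<noteq> c \<and> eigenvalue A e"
  obtain es where es: "char_poly A = (\<Prod>a\<leftarrow>es. [:- a, 1:])" and len: "length es = d"
    using char_poly_factorized[OF A] by blast
  have roots: "e = c" if "e \<in> set es" for e
    using none that eigenvalue_root_char_poly[OF A, of e] es
    by (auto simp: poly_prod_list prod_list_zero_iff)
  obtain B where B: "B \<in> carrier_mat d d" "upper_triangular B" "similar_mat A B"
    using schur_decomposition_exists[OF A es] by blast
  have prods: "(\<Prod>a\<leftarrow>diag_mat B. [:- a, 1:]) = (\<Prod>a\<leftarrow>es. [:- a, 1:])"
    using char_poly_upper_triangular[OF B(1,2)] char_poly_similar[OF B(3)] es by simp
  have "B $$ (i, i) = c" if "i < d" for i
  proof -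
    have "poly (\<Prod>a\<leftarrow>diag_mat B. [:- a, 1:]) (B $$ (i, i)) = 0"
      using that B(1) by (auto simp: poly_prod_list prod_list_zero_iff diag_mat_def)
    then show ?thesis
      using roots prods by (auto simp: poly_prod_list prod_list_zero_iff)
  qed
  then have "trace B = of_nat d * c" using B(1) by (simp add: trace_def)
  then show False using tr trace_similar[OF A B(3)] by simp
qed

lemma cscalar_prod_smult_left:
  assumes "x \<in> carrier_vec d" "y \<in> carrier_vec d"
  shows "(c \<cdot>\<^sub>v x) \<bullet>c y = c * (x \<bullet>c y)"
  using assms by (simp add: cscalar_prod_sum[of _ d] sum_distrib_left mult.assoc)

lemma cscalar_prod_smult_right:
  assumes "x \<in> carrier_vec d" "y \<in> carrier_vec d"
  shows "x \<bullet>c (c \<cdot>\<^sub>v y) = cnj c * (x \<bullet>c y)"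
  using assms by (simp add: cscalar_prod_sum[of _ d] sum_distrib_left mult.assoc mult.left_commute)

text \<open>
  An orthonormal basis diagonalizing \<open>A\<close>, indexed by the natural numbers below \<open>d\<close> together with the real eigenvalues;
  values at larger indices are arbitrary.
\<close>

definition eigenbasis :: "nat \<Rightarrow> complex mat \<Rightarrow> (nat \<Rightarrow> complex vec) \<Rightarrow> (nat \<Rightarrow> real) \<Rightarrow> bool" where
  "eigenbasis d A u l \<longleftrightarrow> A \<in> carrier_mat d d \<and> (\<forall>i<d. u i \<in> carrier_vec d) \<and>
     (\<forall>i<d. \<forall>j<d. u i \<bullet>c u j = (if i = j then 1 else 0)) \<and>
     (\<forall>i<d. A *\<^sub>v u i = complex_of_real (l i) \<cdot>\<^sub>v u i)"

text \<open>
  Changing the eigenvalues of the known eigenvectors \<open>v i\<close> to one real number \<open>c\<close> yields a Hermitian matrix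
  \<open>B\<close>. As \<open>r < d\<close>, its trace is different from \<open>d c\<close> for all but one \<open>c\<close>, so \<open>c\<close> can be chosen such that
  \<open>B\<close> has another eigenvalue. Its eigenvectors are orthogonal to all \<open>v i\<close>, and there \<open>A\<close> and \<open>B\<close> agree.
\<close>

lemma extend_orthonormal_eigenvectors:
  assumes A: "hermitian d A" and "r < d"
    and v: "\<And>i. i < r \<Longrightarrow> v i \<in> carrier_vec d"
    and orth: "\<And>i j. i < r \<Longrightarrow> j < r \<Longrightarrow> v i \<bullet>c v j = (if i = j then 1 else 0)"
    and eig: "\<And>i. i < r \<Longrightarrow> A *\<^sub>v v i = complex_of_real (l i) \<cdot>\<^sub>v v i"
  shows "\<exists>w e. w \<in> carrier_vec d \<and> w \<bullet>c w = 1 \<and> (\<forall>i<r. w \<bullet>c v i = 0) \<and>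
    A *\<^sub>v w = complex_of_real e \<cdot>\<^sub>v w"
proof -
  have Ac: "A \<in> carrier_mat d d" using A by (simp add: hermitian_def)
  \<comment> \<open>The one value of \<open>c\<close> to be avoided is \<open>z\<close>, if it is real.\<close>
  define z where "z = (trace A - (\<Sum>i<r. of_real (l i))) / of_nat (d - r)"
  define c where "c = Re z + 1"
  define B where "B = mat d d (\<lambda>(p, q). A $$ (p, q) +
    (\<Sum>i<r. of_real (c - l i) * v i $ p * cnj (v i $ q)))"
  have Bc: "B \<in> carrier_mat d d" by (simp add: B_def)
  have B_apply: "(B *\<^sub>v x) $ p = (A *\<^sub>v x) $ p + (\<Sum>i<r. of_real (c - l i) * (x \<bullet>c v i) * v i $ p)"
    if "p < d" "x \<in> carrier_vec d" for x p
  proof -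
    have "(B *\<^sub>v x) $ p = (\<Sum>q<d. A $$ (p, q) * x $ q +
        (\<Sum>i<r. of_real (c - l i) * v i $ p * (x $ q * cnj (v i $ q))))"
      using that Bc by (subst mult_mat_vec_sum[of _ d])
        (auto simp: B_def distrib_right sum_distrib_right mult.assoc mult.commute[of "cnj _"] intro!: sum.cong)
    also have "\<dots> = (\<Sum>q<d. A $$ (p, q) * x $ q) +
        (\<Sum>q<d. \<Sum>i<r. of_real (c - l i) * v i $ p * (x $ q * cnj (v i $ q)))"
      by (rule sum.distrib)
    also have "(\<Sum>q<d. \<Sum>i<r. of_real (c - l i) * v i $ p * (x $ q * cnj (v i $ q))) =
        (\<Sum>i<r. \<Sum>q<d. of_real (c - l i) * v i $ p * (x $ q * cnj (v i $ q)))"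
      by (rule sum.swap)
    also have "\<dots> = (\<Sum>i<r. of_real (c - l i) * (x \<bullet>c v i) * v i $ p)"
      using that v by (intro sum.cong refl)
        (simp add: cscalar_prod_sum[of _ d] sum_distrib_left sum_distrib_right mult_ac)
    finally show ?thesis using that Ac by (simp add: mult_mat_vec_sum del: index_mult_mat_vec)
  qed
  have B_herm: "hermitian d B"
  proof -
    have "B $$ (p, q) = cnj (B $$ (q, p))" if "p < d" "q < d" for p q
    proof -
      have "A $$ (p, q) = cnj (A $$ (q, p))" using A that unfolding hermitian_def by blast
      then show ?thesis using that by (simp add: B_def mult_ac)
    qed
    then show ?thesis using Bc unfolding hermitian_def by blast
  qed
  have B_v: "B *\<^sub>v v k = complex_of_real c \<cdot>\<^sub>v v k" if "k < r" for k
  proof (intro eq_vecI)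
    fix p assume "p < dim_vec (complex_of_real c \<cdot>\<^sub>v v k)"
    then have p: "p < d" using v[OF that] by simp
    have "(\<Sum>i<r. of_real (c - l i) * (v k \<bullet>c v i) * v i $ p) =
      (\<Sum>i<r. if i = k then of_real (c - l i) * v i $ p else 0)"
      using orth[OF that] by (intro sum.cong refl) auto
    then have "(B *\<^sub>v v k) $ p = of_real (l k) * v k $ p + of_real (c - l k) * v k $ p"
      using B_apply[OF p v[OF that]] eig[OF that] v[OF that] p that by simp
    then show "(B *\<^sub>v v k) $ p = (complex_of_real c \<cdot>\<^sub>v v k) $ p"
      using p v[OF that] by (simp add: algebra_simps)
  qed (use Bc v[OF that] in auto)
  have "trace B = trace A + (\<Sum>p<d. \<Sum>i<r. of_real (c - l i) * (v i $ p * cnj (v i $ p)))"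
    using Bc Ac by (simp add: trace_def B_def sum.distrib mult.assoc)
  also have "\<dots> = trace A + (\<Sum>i<r. of_real (c - l i) * (v i \<bullet>c v i))"
    using v by (subst sum.swap) (simp add: cscalar_prod_sum[of _ d] sum_distrib_left)
  also have "\<dots> = trace A + of_nat r * of_real c - (\<Sum>i<r. of_real (l i))"
    using orth by (simp add: sum_subtractf)
  finally have trB: "trace B = trace A + of_nat r * of_real c - (\<Sum>i<r. of_real (l i))" .
  have "trace B \<noteq> of_nat d * complex_of_real c"
  proof
    assume "trace B = of_nat d * complex_of_real c"
    then have "trace A - (\<Sum>i<r. of_real (l i)) = of_nat (d - r) * complex_of_real c"
      using trB \<open>r < d\<close> by (simp add: of_nat_diff algebra_simps)
    then have "z = complex_of_real c" using \<open>r < d\<close> unfolding z_def by simp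
    then have "Re z = c" by simp
    then show False by (simp add: c_def)
  qed
  then obtain e x where e: "e \<noteq> complex_of_real c" and "eigenvector B x e"
    using exists_other_eigenvalue[OF Bc] unfolding eigenvalue_def by blast
  then have x: "x \<in> carrier_vec d" "x \<noteq> 0\<^sub>v d" "B *\<^sub>v x = e \<cdot>\<^sub>v x"
    using Bc by (auto simp: eigenvector_def)
  have x_orth: "x \<bullet>c v k = 0" if "k < r" for k
  proof -
    have "e * (x \<bullet>c v k) = (B *\<^sub>v x) \<bullet>c v k"
      using x v[OF that] by (simp add: cscalar_prod_smult_left[of _ d])
    also have "\<dots> = x \<bullet>c (B *\<^sub>v v k)"
      by (rule hermitian_adjoint[OF B_herm x(1) v[OF that]])
    also have "\<dots> = of_real c * (x \<bullet>c v k)"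
      using x v[OF that] B_v[OF that] by (simp add: cscalar_prod_smult_right[of _ d])
    finally show ?thesis using e by simp
  qed
  have Ax: "A *\<^sub>v x = e \<cdot>\<^sub>v x"
  proof (intro eq_vecI)
    fix p assume "p < dim_vec (e \<cdot>\<^sub>v x)"
    then show "(A *\<^sub>v x) $ p = (e \<cdot>\<^sub>v x) $ p"
      using B_apply[of p x] x x_orth by simp
  qed (use Ac x in auto)
  have pos: "0 < sq_norm x"
    using sq_norm_nonneg[OF x(1)] sq_norm_eq_0[OF x(1)] x(2) by fastforce
  have "e * (x \<bullet>c x) = cnj e * (x \<bullet>c x)"
    using hermitian_adjoint[OF A x(1) x(1)] x
    by (simp add: Ax cscalar_prod_smult_left[of _ d] cscalar_prod_smult_right[of _ d])
  then have "e = cnj e" using pos by (simp add: cscalar_prod_self[OF x(1)])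
  then have e_real: "e = complex_of_real (Re e)"
    by (metis complex_is_Real_iff Reals_cnj_iff of_real_Re)
  define w where "w = complex_of_real (1 / sqrt (sq_norm x)) \<cdot>\<^sub>v x"
  have "w \<bullet>c w = 1"
    using x(1) pos by (simp add: w_def cscalar_prod_self[of _ d] sq_norm_smult[of _ d] norm_divide
      power_divide)
  moreover have "w \<bullet>c v i = 0" if "i < r" for i
    using x(1) v[OF that] x_orth[OF that] by (simp add: w_def cscalar_prod_smult_left[of _ d])
  moreover have "A *\<^sub>v w = complex_of_real (Re e) \<cdot>\<^sub>v w"
    using x(1) Ax Ac by (simp add: w_def mult_mat_vec smult_smult_assoc mult.commute flip: e_real)
  moreover have "w \<in> carrier_vec d" using x(1) by (simp add: w_def)
  ultimately show ?thesis by blast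
qed

theorem hermitian_eigenbasis:
  assumes "hermitian d A"
  shows "\<exists>u l. eigenbasis d A u l"
proof -
  have Ac: "A \<in> carrier_mat d d" using assms by (simp add: hermitian_def)
  have "\<exists>u l. (\<forall>i<r. u i \<in> carrier_vec d) \<and>
     (\<forall>i<r. \<forall>j<r. u i \<bullet>c u j = (if i = j then 1 else 0)) \<and>
     (\<forall>i<r. A *\<^sub>v u i = complex_of_real (l i) \<cdot>\<^sub>v u i)" if "r \<le> d" for r
    using that
  proof (induction r)
    case (Suc r)
    then obtain u l where u: "\<forall>i<r. u i \<in> carrier_vec d"
      "\<forall>i<r. \<forall>j<r. u i \<bullet>c u j = (if i = j then 1 else 0)"
      "\<forall>i<r. A *\<^sub>v u i = complex_of_real (l i) \<cdot>\<^sub>v u i" by auto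
    then obtain w e where w: "w \<in> carrier_vec d" "w \<bullet>c w = 1" "\<forall>i<r. w \<bullet>c u i = 0"
      "A *\<^sub>v w = complex_of_real e \<cdot>\<^sub>v w"
      using extend_orthonormal_eigenvectors[OF assms, of r u l] Suc.prems by auto
    have "u i \<bullet>c w = 0" if "i < r" for i
      using w(3) that cscalar_prod_commute[OF w(1), of "u i"] u(1) by simp
    with u w show ?case
      by (intro exI[of _ "u(r := w)"] exI[of _ "l(r := e)"]) (auto simp: less_Suc_eq)
  qed auto
  from this[of d] Ac show ?thesis by (auto simp: eigenbasis_def)
qed

lemma eigenbasisD:
  assumes "eigenbasis d A u l"
  shows "A \<in> carrier_mat d d" "\<And>i. i < d \<Longrightarrow> u i \<in> carrier_vec d"
    "\<And>i j. i < d \<Longrightarrow> j < d \<Longrightarrow> u i \<bullet>c u j = (if i = j then 1 else 0)"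
    "\<And>i. i < d \<Longrightarrow> A *\<^sub>v u i = complex_of_real (l i) \<cdot>\<^sub>v u i"
  using assms unfolding eigenbasis_def by blast+

text \<open>
  A left inverse of a square matrix is also a right inverse: orthonormality of the rows follows from that of the columns.
\<close>

lemma orthonormal_completeness:
  assumes u: "\<And>i. i < d \<Longrightarrow> u i \<in> carrier_vec d"
    and orth: "\<And>i j. i < d \<Longrightarrow> j < d \<Longrightarrow> u i \<bullet>c u j = (if i = j then 1 else 0)"
    and "p < d" "q < d"
  shows "(\<Sum>k<d. u k $ p * cnj (u k $ q)) = (if p = q then 1 else 0)"
proof -
  define U where "U = mat d d (\<lambda>(i, j). u j $ i)"
  define V where "V = mat d d (\<lambda>(i, j). cnj (u i $ j))"
  have "V * U = 1\<^sub>m d"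
  proof (intro eq_matI)
    fix i j assume ij: "i < dim_row (1\<^sub>m d :: complex mat)" "j < dim_col (1\<^sub>m d :: complex mat)"
    then have "(V * U) $$ (i, j) = (\<Sum>k<d. u j $ k * cnj (u i $ k))"
      by (simp add: U_def V_def scalar_prod_def lessThan_atLeast0 mult.commute)
    then show "(V * U) $$ (i, j) = 1\<^sub>m d $$ (i, j)"
      using ij orth[of j i] u by (cases "i = j") (simp_all add: cscalar_prod_sum[of _ d])
  qed (auto simp: U_def V_def)
  then have "U * V = 1\<^sub>m d"
    by (intro mat_mult_left_right_inverse[of V d U]) (auto simp: U_def V_def)
  then have "(U * V) $$ (p, q) = (if p = q then 1 else 0)" using assms by simp
  then show ?thesis using assms by (simp add: U_def V_def scalar_prod_def lessThan_atLeast0)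
qed

text \<open>
  The spectral decomposition as a sum of rank one matrices.
\<close>

lemma eigenbasis_entry:
  assumes e: "eigenbasis d A u l" and "p < d" "q < d"
  shows "A $$ (p, q) = (\<Sum>k<d. of_real (l k) * u k $ p * cnj (u k $ q))"
proof -
  note e = eigenbasisD[OF e]
  have "A $$ (p, q) = (\<Sum>j<d. if j = q then A $$ (p, j) else 0)" using assms by simp
  also have "\<dots> = (\<Sum>j<d. A $$ (p, j) * (\<Sum>k<d. u k $ j * cnj (u k $ q)))"
    using orthonormal_completeness[OF e(2,3)] assms by (intro sum.cong) auto
  also have "\<dots> = (\<Sum>k<d. (\<Sum>j<d. A $$ (p, j) * u k $ j) * cnj (u k $ q))"
    by (simp add: sum_distrib_left sum_distrib_right mult.assoc) (rule sum.swap)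
  also have "\<dots> = (\<Sum>k<d. (A *\<^sub>v u k) $ p * cnj (u k $ q))"
    using mult_mat_vec_sum[OF e(1) e(2) assms(2)] by (intro sum.cong) auto
  also have "\<dots> = (\<Sum>k<d. of_real (l k) * u k $ p * cnj (u k $ q))"
    using e(4) carrier_vecD[OF e(2)] assms by (intro sum.cong) auto
  finally show ?thesis .
qed

lemma eigenbasis_unique_matrix:
  assumes "eigenbasis d A u l" "eigenbasis d B u m" "\<And>i. i < d \<Longrightarrow> l i = m i"
  shows "A = B"
  using assms eigenbasisD(1)[OF assms(1)] eigenbasisD(1)[OF assms(2)]
  by (intro eq_matI) (auto simp: eigenbasis_entry)

lemma eigenbasis_hermitian:
  assumes "eigenbasis d A u l"
  shows "hermitian d A"
  unfolding hermitian_def using eigenbasisD(1)[OF assms] eigenbasis_entry[OF assms]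
  by (auto simp: mult_ac)

lemma eigenbasis_add:
  assumes "eigenbasis d A u l" "eigenbasis d B u m"
  shows "eigenbasis d (A + B) u (\<lambda>i. l i + m i)"
  using assms unfolding eigenbasis_def
  by (auto simp: add_mult_distrib_mat_vec add_smult_distrib_vec)

lemma parseval:
  assumes u: "\<And>i. i < d \<Longrightarrow> u i \<in> carrier_vec d"
    and orth: "\<And>i j. i < d \<Longrightarrow> j < d \<Longrightarrow> u i \<bullet>c u j = (if i = j then 1 else 0)"
    and x: "x \<in> carrier_vec d"
  shows "sq_norm x = (\<Sum>k<d. (cmod (x \<bullet>c u k))\<^sup>2)"
proof -
  have "complex_of_real (\<Sum>k<d. (cmod (x \<bullet>c u k))\<^sup>2) = (\<Sum>k<d. (x \<bullet>c u k) * cnj (x \<bullet>c u k))"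
    by (simp add: complex_norm_square[symmetric])
  also have "\<dots> = (\<Sum>k<d. \<Sum>i<d. \<Sum>j<d. (x $ i * cnj (x $ j)) * (u k $ j * cnj (u k $ i)))"
    using x u by (simp add: cscalar_prod_sum[of _ d] sum_product mult_ac)
  also have "\<dots> = (\<Sum>i<d. \<Sum>j<d. \<Sum>k<d. (x $ i * cnj (x $ j)) * (u k $ j * cnj (u k $ i)))"
    by (rule trans[OF sum.swap], rule sum.cong[OF refl], rule sum.swap)
  also have "\<dots> = (\<Sum>i<d. \<Sum>j<d. if i = j then x $ i * cnj (x $ j) else 0)"
    using orthonormal_completeness[OF u orth]
    by (intro sum.cong[OF refl]) (simp add: sum_distrib_left[symmetric])
  also have "\<dots> = complex_of_real (sq_norm x)"
    using x cscalar_prod_self[OF x] by (simp add: cscalar_prod_sum[of _ d])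
  finally show ?thesis by (simp only: of_real_eq_iff)
qed

lemma qform_eigenbasis:
  assumes e: "eigenbasis d A u l" and x: "x \<in> carrier_vec d"
  shows "qform A x = (\<Sum>k<d. l k * (cmod (x \<bullet>c u k))\<^sup>2)"
proof -
  note e' = eigenbasisD[OF e]
  have "(A *\<^sub>v x) \<bullet>c x = (\<Sum>i<d. \<Sum>j<d. \<Sum>k<d. of_real (l k) * u k $ i * cnj (u k $ j) * x $ j * cnj (x $ i))"
    using e' x by (simp add: cscalar_prod_sum[of _ d] mult_mat_vec_sum[of _ d] eigenbasis_entry[OF e]
        sum_distrib_right sum_distrib_left mult_ac del: index_mult_mat_vec)
  also have "\<dots> = (\<Sum>i<d. \<Sum>k<d. \<Sum>j<d. of_real (l k) * u k $ i * cnj (u k $ j) * x $ j * cnj (x $ i))"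
    by (rule sum.cong[OF refl], rule sum.swap)
  also have "\<dots> = (\<Sum>k<d. \<Sum>i<d. \<Sum>j<d. of_real (l k) * u k $ i * cnj (u k $ j) * x $ j * cnj (x $ i))"
    by (rule sum.swap)
  also have "\<dots> = (\<Sum>k<d. of_real (l k) * ((x \<bullet>c u k) * cnj (x \<bullet>c u k)))"
    using e' x by (simp add: cscalar_prod_sum[of _ d] sum_product sum_distrib_left mult_ac)
  also have "\<dots> = complex_of_real (\<Sum>k<d. l k * (cmod (x \<bullet>c u k))\<^sup>2)"
    by (simp add: complex_norm_square[symmetric])
  finally show ?thesis unfolding qform_def by simp
qed

lemma trace_eigenbasis:
  assumes e: "eigenbasis d A u l"
  shows "trace A = of_real (\<Sum>k<d. l k)"
proof -
  note e' = eigenbasisD[OF e]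
  have "trace A = (\<Sum>p<d. \<Sum>k<d. of_real (l k) * (u k $ p * cnj (u k $ p)))"
    using e' by (simp add: trace_def eigenbasis_entry[OF e] mult.assoc)
  also have "\<dots> = (\<Sum>k<d. of_real (l k) * (u k \<bullet>c u k))"
    using e'(2) by (subst sum.swap) (simp add: cscalar_prod_sum[of _ d] sum_distrib_left)
  also have "\<dots> = (\<Sum>k<d. of_real (l k))"
    using e'(3) by (intro sum.cong) auto
  finally show ?thesis by simp
qed

lemma eigenbasis_char_poly:
  assumes e: "eigenbasis d A u l"
  shows "char_poly A = (\<Prod>i\<leftarrow>[0..<d]. [:- of_real (l i), 1:])"
proof -
  note e' = eigenbasisD[OF e]
  define U where "U = mat d d (\<lambda>(i, j). u j $ i)"
  define V where "V = mat d d (\<lambda>(i, j). cnj (u i $ j))"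
  define D where "D = mat_diag d (\<lambda>i. complex_of_real (l i))"
  have carr: "U \<in> carrier_mat d d" "V \<in> carrier_mat d d" "D \<in> carrier_mat d d"
    by (auto simp: U_def V_def D_def)
  have UV: "U * V = 1\<^sub>m d"
    using orthonormal_completeness[OF e'(2,3)]
    by (intro eq_matI) (auto simp: U_def V_def scalar_prod_def lessThan_atLeast0)
  have VU: "V * U = 1\<^sub>m d" by (rule mat_mult_left_right_inverse[OF carr(1,2) UV])
  have "A = U * D * V"
    using e' carr unfolding D_def mat_diag_mult_right[OF carr(1)]
    by (intro eq_matI) (auto simp: U_def V_def scalar_prod_def lessThan_atLeast0 mult_ac
      eigenbasis_entry[OF e])
  then have "similar_mat A D"
    unfolding similar_mat_def similar_mat_wit_def using e'(1) carr UV VU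
    by (intro exI[of _ U] exI[of _ V]) (auto simp: Let_def)
  then have "char_poly A = char_poly D" by (rule char_poly_similar)
  also have "\<dots> = (\<Prod>a\<leftarrow>diag_mat D. [:- a, 1:])"
    by (rule char_poly_upper_triangular[OF carr(3)]) (auto simp: D_def mat_diag_def)
  also have "diag_mat D = map (\<lambda>i. of_real (l i)) [0..<d]"
    by (auto simp: diag_mat_def D_def mat_diag_def)
  finally show ?thesis by (simp add: o_def)
qed

lemma proots_linear_factors:
  "proots (\<Prod>x\<leftarrow>xs. [:- g x, 1:]) = mset (map g xs)" for g :: "'b \<Rightarrow> 'a :: idom"
proof (induction xs)
  case (Cons x xs)
  have "(\<Prod>x\<leftarrow>xs. [:- g x, 1:]) \<noteq> 0" by (auto simp: prod_list_zero_iff)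
  with Cons show ?case by (simp add: proots_mult del: mult_pCons_left)
qed simp

lemma eigs_dec_eigenbasis:
  assumes e: "eigenbasis d A u l"
  shows "eigs_dec A = dec_rearr (vec d l)"
proof -
  have "image_mset Re (proots (char_poly A)) = mset (map l [0..<d])"
    unfolding eigenbasis_char_poly[OF e] proots_linear_factors by (simp add: multiset.map_comp o_def)
  moreover have "list_of_vec (vec d l) = map l [0..<d]"
    by (auto intro: nth_equalityI simp: list_of_vec_index)
  ultimately show ?thesis
    unfolding eigs_dec_def dec_rearr_def by (metis sorted_list_of_multiset_mset)
qed

section \<open>Sorted spectra\<close>

lemma dim_dec_rearr [simp]: "dim_vec (dec_rearr x) = dim_vec x"
  by (simp add: dec_rearr_def)

lemma sum_eq_sum_list_take:
  "j \<le> length xs \<Longrightarrow> (\<Sum>i<j. vec_of_list xs $ i) = sum_list (take j xs)"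
  by (simp add: sum_list_sum_nth lessThan_atLeast0 vec_of_list_index)

lemma decreasing_iff_sorted:
  "sorted_wrt (\<ge>) (list_of_vec x) \<longleftrightarrow> (\<forall>i j. i \<le> j \<longrightarrow> j < dim_vec x \<longrightarrow> x $ j \<le> x $ i)"
  for x :: "real vec"
  unfolding sorted_wrt_iff_nth_less by (auto simp: list_of_vec_index le_less)

lemma sorted_rev_sort: "sorted_wrt (\<ge>) (rev (sort xs))"
  using sorted_wrt_rev[of "(\<ge>)" "rev (sort xs)"] by (simp add: sorted_wrt_rev)

lemma dec_rearr_decreasing:
  assumes "i \<le> j" "j < dim_vec x"
  shows "dec_rearr x $ j \<le> dec_rearr x $ i"
  using decreasing_iff_sorted[of "dec_rearr x"] sorted_rev_sort[of "list_of_vec x"] assms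
  by (simp add: dec_rearr_def list_vec)

lemma rev_sort_eq:
  fixes xs :: "real list"
  assumes "mset ys = mset xs" "sorted_wrt (\<ge>) ys"
  shows "rev (sort xs) = ys"
proof -
  have "sort xs = rev ys"
    using assms by (intro properties_for_sort) (auto simp: sorted_wrt_rev)
  then show ?thesis by simp
qed

lemma dec_rearr_id:
  assumes "\<And>i j. i \<le> j \<Longrightarrow> j < dim_vec x \<Longrightarrow> x $ j \<le> x $ i"
  shows "dec_rearr x = x"
  using rev_sort_eq[of "list_of_vec x" "list_of_vec x"] decreasing_iff_sorted[of x] assms
  by (simp add: dec_rearr_def vec_list)

lemma dec_rearr_eq_iff:
  "dec_rearr x = dec_rearr y \<longleftrightarrow> mset (list_of_vec x) = mset (list_of_vec y)"
proof
  assume "dec_rearr x = dec_rearr y"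
  then have "mset (list_of_vec (dec_rearr x)) = mset (list_of_vec (dec_rearr y))" by simp
  then show "mset (list_of_vec x) = mset (list_of_vec y)" by (simp add: dec_rearr_def list_vec)
next
  assume "mset (list_of_vec x) = mset (list_of_vec y)"
  then have "sort (list_of_vec x) = sort (list_of_vec y)" by (metis sorted_list_of_multiset_mset)
  then show "dec_rearr x = dec_rearr y" by (simp add: dec_rearr_def)
qed

lemma dec_rearr_permutation:
  obtains p where "p permutes {..<dim_vec x}" "\<And>i. i < dim_vec x \<Longrightarrow> dec_rearr x $ i = x $ p i"
proof -
  have "mset (rev (sort (list_of_vec x))) = mset (list_of_vec x)" by simp
  then obtain p where p: "p permutes {..<length (list_of_vec x)}"
    "permute_list p (list_of_vec x) = rev (sort (list_of_vec x))"
    by (metis mset_eq_permutation)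
  show ?thesis
  proof
    show "p permutes {..<dim_vec x}" using p(1) by simp
    fix i assume i: "i < dim_vec x"
    then have "p i < dim_vec x" using p(1) permutes_in_image[of p "{..<dim_vec x}" i] by simp
    with i have "rev (sort (list_of_vec x)) ! i = x $ p i"
      using p by (simp flip: p(2) add: permute_list_nth list_of_vec_index)
    then show "dec_rearr x $ i = x $ p i" using i by (simp add: dec_rearr_def vec_of_list_index)
  qed
qed

lemma sum_fun_dec_rearr:
  assumes "dim_vec x = d"
  shows "sum_fun d f (dec_rearr x) = sum_fun d f x"
proof -
  obtain p where p: "p permutes {..<d}" "\<And>i. i < d \<Longrightarrow> dec_rearr x $ i = x $ p i"
    using dec_rearr_permutation[of x] assms by metis
  then have "sum_fun d f (dec_rearr x) = (\<Sum>i<d. f (x $ p i))" by (simp add: sum_fun_def)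
  also have "\<dots> = (\<Sum>i<d. f (x $ i))" using sum.permute[OF p(1), of "\<lambda>i. f (x $ i)"] by (simp add: o_def)
  finally show ?thesis by (simp add: sum_fun_def)
qed

lemma eigenbasis_permute:
  assumes "eigenbasis d A u l" "p permutes {..<d}"
  shows "eigenbasis d A (u \<circ> p) (l \<circ> p)"
proof -
  have "p i < d" if "i < d" for i using permutes_in_image[OF assms(2), of i] that by simp
  moreover have "p i = p j \<longleftrightarrow> i = j" for i j
    using permutes_inj[OF assms(2)] by (auto dest: injD)
  ultimately show ?thesis using assms(1) by (auto simp: eigenbasis_def)
qed

lemma eigenbasis_cong:
  assumes "eigenbasis d A u l" "\<And>i. i < d \<Longrightarrow> l i = m i"
  shows "eigenbasis d A u m"
  using assms by (auto simp: eigenbasis_def)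

text \<open>
  The multiset of characteristic roots lists the eigenvalues of any eigenbasis, so permuting the basis
  puts them into the order of \<open>eigs_dec\<close>.
\<close>

lemma hermitian_eigs_dec:
  assumes "hermitian d A"
  shows "\<exists>u. eigenbasis d A u (\<lambda>i. eigs_dec A $ i)" "dim_vec (eigs_dec A) = d"
    "\<And>i j. i \<le> j \<Longrightarrow> j < d \<Longrightarrow> eigs_dec A $ j \<le> eigs_dec A $ i"
proof -
  obtain u l where e: "eigenbasis d A u l" using hermitian_eigenbasis[OF assms] by blast
  note eigs = eigs_dec_eigenbasis[OF e]
  obtain p where p: "p permutes {..<d}" "\<And>i. i < d \<Longrightarrow> eigs_dec A $ i = vec d l $ p i"
    using dec_rearr_permutation[of "vec d l"] by (simp add: eigs) blast
  have "p i < d" if "i < d" for i using permutes_in_image[OF p(1), of i] that by simp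
  then have "eigenbasis d A (u \<circ> p) (\<lambda>i. eigs_dec A $ i)"
    using p(2) by (intro eigenbasis_cong[OF eigenbasis_permute[OF e p(1)]]) simp
  then show "\<exists>u. eigenbasis d A u (\<lambda>i. eigs_dec A $ i)" by blast
  show "dim_vec (eigs_dec A) = d" by (simp add: eigs)
  show "eigs_dec A $ j \<le> eigs_dec A $ i" if "i \<le> j" "j < d" for i j
    using dec_rearr_decreasing[of i j "vec d l"] that by (simp add: eigs)
qed

section \<open>Weyl and Lidskii inequalities\<close>

text \<open>
  Half of the Courant--Fischer principle. The span of the eigenvectors \<open>u 0, \<dots>, u q\<close> has dimension
  \<open>q + 1\<close> and therefore contains a nonzero vector satisfying \<open>q\<close> linear conditions. Dimensions do not
  appear in the proof: the conditions together with orthogonality to the other eigenvectors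
  form a square system that has a zero row.
\<close>

lemma exists_vector_large_qform:
  assumes e: "eigenbasis d A u l" and dec: "\<And>i j. i \<le> j \<Longrightarrow> j < d \<Longrightarrow> l j \<le> l i"
    and "q < d" and v: "\<And>j. j < q \<Longrightarrow> v j \<in> carrier_vec d"
  obtains x where "x \<in> carrier_vec d" "0 < sq_norm x" "\<And>j. j < q \<Longrightarrow> x \<bullet>c v j = 0"
    "l q * sq_norm x \<le> qform A x"
proof -
  note e' = eigenbasisD[OF e]
  define M where "M = mat\<^sub>r d d (\<lambda>i. if i = q then 0\<^sub>v d else if i < q then conjugate (v i) else conjugate (u i))"
  have M: "M \<in> carrier_mat d d" by (simp add: M_def)
  have rows: "row M i = (if i < q then conjugate (v i) else if i = q then 0\<^sub>v d else conjugate (u i))"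
    if "i < d" for i
    using that v e' unfolding M_def by (intro eq_vecI) auto
  have "det M = 0"
    unfolding M_def using \<open>q < d\<close> by (intro det_row_0) (auto simp: e' v)
  then obtain x where x: "x \<in> carrier_vec d" "x \<noteq> 0\<^sub>v d" "M *\<^sub>v x = 0\<^sub>v d"
    using det_0_iff_vec_prod_zero[OF M] by blast
  have row_x: "row M i \<bullet> x = 0" if "i < d" for i
    using arg_cong[OF x(3), of "\<lambda>w. w $ i"] M that by simp
  have v_x: "x \<bullet>c v j = 0" if "j < q" for j
    using row_x[of j] rows[of j] that \<open>q < d\<close> v[OF that] x(1)
    by (metis comm_scalar_prod carrier_vec_conjugate order.strict_trans)
  have u_x: "x \<bullet>c u j = 0" if "q < j" "j < d" for j
    using row_x[of j] rows[of j] that e'(2)[of j] x(1)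
    by (metis comm_scalar_prod carrier_vec_conjugate order.asym less_irrefl)
  have "l q * sq_norm x = (\<Sum>k<d. l q * (cmod (x \<bullet>c u k))\<^sup>2)"
    using parseval[OF e'(2,3) x(1)] by (simp add: sum_distrib_left)
  also have "\<dots> \<le> (\<Sum>k<d. l k * (cmod (x \<bullet>c u k))\<^sup>2)"
  proof (intro sum_mono)
    fix k assume "k \<in> {..<d}"
    then show "l q * (cmod (x \<bullet>c u k))\<^sup>2 \<le> l k * (cmod (x \<bullet>c u k))\<^sup>2"
      using u_x[of k] dec[of k q] \<open>q < d\<close> by (cases "q < k") (auto intro: mult_right_mono)
  qed
  also have "\<dots> = qform A x" using qform_eigenbasis[OF e x(1)] by simp
  finally have "l q * sq_norm x \<le> qform A x" .
  moreover have "0 < sq_norm x"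
    using sq_norm_nonneg[OF x(1)] sq_norm_eq_0[OF x(1)] x(2) by fastforce
  ultimately show ?thesis using that x(1) v_x by blast
qed

lemma qform_upper_bound:
  assumes e: "eigenbasis d B v m" and x: "x \<in> carrier_vec d"
    and le: "\<And>k. k < d \<Longrightarrow> x \<bullet>c v k \<noteq> 0 \<Longrightarrow> m k \<le> t"
  shows "qform B x \<le> t * sq_norm x"
proof -
  note e' = eigenbasisD[OF e]
  have "qform B x = (\<Sum>k<d. m k * (cmod (x \<bullet>c v k))\<^sup>2)" by (rule qform_eigenbasis[OF e x])
  also have "\<dots> \<le> (\<Sum>k<d. t * (cmod (x \<bullet>c v k))\<^sup>2)"
  proof (intro sum_mono)
    fix k assume "k \<in> {..<d}"
    then show "m k * (cmod (x \<bullet>c v k))\<^sup>2 \<le> t * (cmod (x \<bullet>c v k))\<^sup>2"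
      using le[of k] by (cases "x \<bullet>c v k = 0") (auto intro: mult_right_mono)
  qed
  finally show ?thesis using parseval[OF e'(2,3) x] by (simp add: sum_distrib_left)
qed

text \<open>
  The \<open>q\<close> conditions are orthogonality to the top eigenvectors of \<open>B\<close>; what remains of \<open>B\<close> is bounded
  by \<open>m q\<close>.
\<close>

lemma weyl_monotone:
  assumes A: "eigenbasis d A u l" "\<And>i j. i \<le> j \<Longrightarrow> j < d \<Longrightarrow> l j \<le> l i"
    and B: "eigenbasis d B v m" "\<And>i j. i \<le> j \<Longrightarrow> j < d \<Longrightarrow> m j \<le> m i"
    and le: "\<And>x. x \<in> carrier_vec d \<Longrightarrow> qform A x \<le> qform B x"
    and "q < d"
  shows "l q \<le> m q"
proof -
  obtain x where x: "x \<in> carrier_vec d" "0 < sq_norm x" "\<And>j. j < q \<Longrightarrow> x \<bullet>c v j = 0"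
    "l q * sq_norm x \<le> qform A x"
    using exists_vector_large_qform[OF A \<open>q < d\<close>, of v] eigenbasisD(2)[OF B(1)] \<open>q < d\<close> by auto
  have "qform B x \<le> m q * sq_norm x"
    using B(2) x(3) by (intro qform_upper_bound[OF B(1) x(1)]) (metis not_le)
  then show ?thesis using x le[OF x(1)] by (smt (verit) mult_le_cancel_right_pos)
qed

text \<open>
  The \<open>q\<close> conditions are now orthogonality to the bottom eigenvectors of \<open>B\<close>, so that the remaining part of
  \<open>B\<close> is bounded from below by \<open>m (d - 1 - q)\<close>.
\<close>

lemma weyl_opposite:
  assumes A: "eigenbasis d A u l" "\<And>i j. i \<le> j \<Longrightarrow> j < d \<Longrightarrow> l j \<le> l i"
    and B: "eigenbasis d B v m" "\<And>i j. i \<le> j \<Longrightarrow> j < d \<Longrightarrow> m j \<le> m i"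
    and le: "\<And>x. x \<in> carrier_vec d \<Longrightarrow> qform A x + qform B x \<le> t * sq_norm x"
    and "q < d"
  shows "l q + m (d - 1 - q) \<le> t"
proof -
  obtain x where x: "x \<in> carrier_vec d" "0 < sq_norm x"
    "\<And>j. j < q \<Longrightarrow> x \<bullet>c v (d - 1 - j) = 0" "l q * sq_norm x \<le> qform A x"
    using exists_vector_large_qform[OF A \<open>q < d\<close>, of "\<lambda>j. v (d - 1 - j)"]
      eigenbasisD(2)[OF B(1)] \<open>q < d\<close> by auto
  have orth: "x \<bullet>c v k = 0" if "d - 1 - q < k" "k < d" for k
    using x(3)[of "d - 1 - k"] that by simp
  have "m (d - 1 - q) * sq_norm x \<le> qform B x"
  proof -
    have "(\<Sum>k<d. m (d - 1 - q) * (cmod (x \<bullet>c v k))\<^sup>2) \<le> (\<Sum>k<d. m k * (cmod (x \<bullet>c v k))\<^sup>2)"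
    proof (intro sum_mono)
      fix k assume "k \<in> {..<d}"
      then show "m (d - 1 - q) * (cmod (x \<bullet>c v k))\<^sup>2 \<le> m k * (cmod (x \<bullet>c v k))\<^sup>2"
        using orth[of k] B(2)[of k "d - 1 - q"] \<open>q < d\<close>
        by (cases "d - 1 - q < k") (auto intro: mult_right_mono)
    qed
    then show ?thesis
      using parseval[OF eigenbasisD(2,3)[OF B(1)] x(1)] qform_eigenbasis[OF B(1) x(1)]
      by (simp add: sum_distrib_left)
  qed
  then have "(l q + m (d - 1 - q)) * sq_norm x \<le> t * sq_norm x"
    using x(4) le[OF x(1)] by (simp add: distrib_right)
  then show ?thesis using x(2) by simp
qed

section \<open>Frame operators\<close>

lemma hermitian_decreasing_eigenbasis:
  assumes "hermitian d A"
  obtains u l where "eigenbasis d A u l" "\<And>i j. i \<le> j \<Longrightarrow> j < d \<Longrightarrow> l j \<le> l i"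
  using hermitian_eigs_dec[OF assms] by blast

lemma frame_op_Nil [simp]: "frame_op d [] = 0\<^sub>m d d"
  and frame_op_Cons: "frame_op d (g # G) = rank_one g g + frame_op d G"
  by (simp_all add: frame_op_def)

lemma rank_one_carrier: "g \<in> carrier_vec d \<Longrightarrow> rank_one g g \<in> carrier_mat d d"
  by (simp add: rank_one_def)

lemma frame_op_carrier: "set G \<subseteq> carrier_vec d \<Longrightarrow> frame_op d G \<in> carrier_mat d d"
  by (induction G) (auto simp: frame_op_Cons rank_one_carrier)

lemma frame_op_entry:
  assumes "set G \<subseteq> carrier_vec d" "i < d" "j < d"
  shows "frame_op d G $$ (i, j) = (\<Sum>g\<leftarrow>G. g $ i * cnj (g $ j))"
  using assms(1)
proof (induction G)
  case (Cons g G)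
  then have "frame_op d G \<in> carrier_mat d d" "g \<in> carrier_vec d"
    by (auto intro: frame_op_carrier)
  then show ?case using Cons assms by (simp add: frame_op_Cons rank_one_def)
qed (use assms in simp)

lemma frame_op_append:
  assumes "set F \<subseteq> carrier_vec d" "set G \<subseteq> carrier_vec d"
  shows "frame_op d (F @ G) = frame_op d F + frame_op d G"
  using assms frame_op_carrier[of F d] frame_op_carrier[of G d] frame_op_carrier[of "F @ G" d]
  by (intro eq_matI) (auto simp: frame_op_entry)

lemma frame_op_mset_cong:
  assumes "mset F = mset G" "set G \<subseteq> carrier_vec d"
  shows "frame_op d F = frame_op d G"
proof -
  have F: "set F \<subseteq> carrier_vec d" using assms mset_eq_setD by blast
  have "(\<Sum>g\<leftarrow>F. h g) = (\<Sum>g\<leftarrow>G. h g)" for h :: "complex vec \<Rightarrow> complex"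
    using assms(1) by (metis mset_map sum_mset_sum_list)
  then show ?thesis using assms F frame_op_carrier[of F d] frame_op_carrier[of G d]
    by (intro eq_matI) (auto simp: frame_op_entry)
qed

lemma hermitian_frame_op:
  assumes "set G \<subseteq> carrier_vec d"
  shows "hermitian d (frame_op d G)"
proof -
  have "frame_op d G $$ (i, j) = cnj (frame_op d G $$ (j, i))" if "i < d" "j < d" for i j
    unfolding frame_op_entry[OF assms that] frame_op_entry[OF assms that(2,1)]
    by (induction G) (auto simp: mult.commute)
  then show ?thesis using frame_op_carrier[OF assms] unfolding hermitian_def by blast
qed

lemma qform_frame_op:
  assumes "set G \<subseteq> carrier_vec d" "x \<in> carrier_vec d"
  shows "qform (frame_op d G) x = (\<Sum>g\<leftarrow>G. (cmod (x \<bullet>c g))\<^sup>2)"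
  using assms(1)
proof (induction G)
  case Nil
  then show ?case using assms(2) by (auto simp: qform_def scalar_prod_def)
next
  case (Cons g G)
  then have g: "g \<in> carrier_vec d" and G: "frame_op d G \<in> carrier_mat d d"
    by (auto intro: frame_op_carrier)
  have "(rank_one g g *\<^sub>v x) \<bullet>c x = (x \<bullet>c g) * (g \<bullet>c x)"
    using g assms(2) by (simp add: rank_one_mult_vec cscalar_prod_smult_left[of _ d])
  also have "\<dots> = complex_of_real ((cmod (x \<bullet>c g))\<^sup>2)"
    unfolding cscalar_prod_commute[OF assms(2) g] by (rule complex_norm_square[symmetric])
  finally have "qform (rank_one g g) x = (cmod (x \<bullet>c g))\<^sup>2" by (simp add: qform_def)
  then show ?case
    using Cons qform_add[OF rank_one_carrier[OF g] G assms(2)] by (simp add: frame_op_Cons)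
qed

lemma trace_frame_op:
  assumes "set G \<subseteq> carrier_vec d"
  shows "trace (frame_op d G) = of_real (\<Sum>g\<leftarrow>G. sq_norm g)"
  using assms
proof (induction G)
  case (Cons g G)
  then have g: "g \<in> carrier_vec d" and G: "frame_op d G \<in> carrier_mat d d"
    by (auto intro: frame_op_carrier)
  have "trace (rank_one g g) = g \<bullet>c g"
    using g by (simp add: trace_def rank_one_def cscalar_prod_sum[of _ d])
  then show ?case
    using Cons trace_add[OF rank_one_carrier[OF g] G] g by (simp add: frame_op_Cons cscalar_prod_self[of _ d])
qed (simp add: trace_def)

lemma eigenbasis_frame_op_nonneg:
  assumes "eigenbasis d (frame_op d G) u l" "set G \<subseteq> carrier_vec d" "i < d"
  shows "0 \<le> l i"
proof -
  note e = eigenbasisD[OF assms(1)]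
  have "qform (frame_op d G) (u i) = l i"
    using e assms(3) by (simp add: qform_def cscalar_prod_smult_left[of _ d])
  moreover have "0 \<le> qform (frame_op d G) (u i)"
    unfolding qform_frame_op[OF assms(2) e(2)[OF assms(3)]] by (auto intro!: sum_list_nonneg)
  ultimately show ?thesis by simp
qed

text \<open>
  The frame made of scaled basis vectors; for nonnegative \<open>m\<close> its frame operator is diagonal in the
  basis \<open>u\<close> with eigenvalues \<open>m 0, \<dots>, m (j - 1), 0, \<dots>\<close>.
\<close>

definition diagonal_frame :: "(nat \<Rightarrow> complex vec) \<Rightarrow> (nat \<Rightarrow> real) \<Rightarrow> nat \<Rightarrow> complex vec list" where
  "diagonal_frame u m j = map (\<lambda>i. complex_of_real (sqrt (m i)) \<cdot>\<^sub>v u i) [0..<j]"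

lemma diagonal_frame_carrier:
  assumes "eigenbasis d A u l" "j \<le> d"
  shows "set (diagonal_frame u m j) \<subseteq> carrier_vec d"
  using eigenbasisD(2)[OF assms(1)] assms(2) by (auto simp: diagonal_frame_def)

lemma eigenbasis_diagonal_frame:
  assumes u: "eigenbasis d A u l" and "j \<le> d" and "\<And>i. i < j \<Longrightarrow> 0 \<le> m i"
  shows "eigenbasis d (frame_op d (diagonal_frame u m j)) u (\<lambda>i. if i < j then m i else 0)"
  using assms(2,3)
proof (induction j)
  case 0
  have "0\<^sub>m d d *\<^sub>v u i = complex_of_real 0 \<cdot>\<^sub>v u i" if "i < d" for i
    using eigenbasisD(2)[OF u that] by (intro eq_vecI) (auto simp: scalar_prod_def)
  then show ?case using eigenbasisD(2,3)[OF u]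
    by (auto simp: eigenbasis_def diagonal_frame_def)
next
  case (Suc j)
  note e = eigenbasisD(2,3)[OF u]
  define g where "g = complex_of_real (sqrt (m j)) \<cdot>\<^sub>v u j"
  have g: "g \<in> carrier_vec d" using e(1)[of j] Suc.prems by (simp add: g_def)
  have "rank_one g g *\<^sub>v u i = complex_of_real (if i = j then m j else 0) \<cdot>\<^sub>v u i" if "i < d" for i
  proof -
    have "rank_one g g *\<^sub>v u i = (u i \<bullet>c g) \<cdot>\<^sub>v g"
      using g e(1)[OF that] by (intro rank_one_mult_vec) simp
    also have "u i \<bullet>c g = (if i = j then complex_of_real (sqrt (m j)) else 0)"
      using e that Suc.prems(1) by (simp add: g_def cscalar_prod_smult_right[of _ d])
    also have "\<dots> \<cdot>\<^sub>v g = complex_of_real (if i = j then m j else 0) \<cdot>\<^sub>v u i"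
      using e(1)[OF that] e(1)[of j] Suc.prems
      by (auto simp: g_def smult_smult_assoc simp flip: of_real_mult)
    finally show ?thesis .
  qed
  then have g_basis: "eigenbasis d (rank_one g g) u (\<lambda>i. if i = j then m j else 0)"
    using e rank_one_carrier[OF g] unfolding eigenbasis_def by blast
  have j_basis: "eigenbasis d (frame_op d (diagonal_frame u m j)) u (\<lambda>i. if i < j then m i else 0)"
    using Suc by simp
  have "frame_op d (diagonal_frame u m (Suc j)) = frame_op d (diagonal_frame u m j) + rank_one g g"
    using frame_op_append[OF diagonal_frame_carrier[OF u], of j "[g]" m] g Suc.prems rank_one_carrier[OF g]
    by (simp add: diagonal_frame_def frame_op_Cons g_def)
  then show ?case
    using eigenbasis_add[OF j_basis g_basis] by (auto elim: eigenbasis_cong simp: less_Suc_eq)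
qed

text \<open>
  The argument of Li and Mathias. Let \<open>j\<close> be the size of \<open>J\<close>, let \<open>t\<close> be the \<open>j\<close>-th eigenvalue of
  \<open>A + B\<close> and let \<open>P\<close> be the positive part of \<open>A + B - t\<close>. Then \<open>A + (B - P)\<close> is at most \<open>t\<close>, so for
  each \<open>i\<close> the opposite eigenvalues of \<open>A\<close> and \<open>B' = B - P\<close> add up to at most \<open>t\<close>. Passing from \<open>B'\<close>
  back to \<open>B\<close> raises every eigenvalue, by the trace of \<open>P\<close> in total. That trace
  is the sum of \<open>c i - t\<close> over \<open>i < j\<close>, and the terms in \<open>t\<close> cancel.
\<close>

theorem lidskii:
  assumes A: "eigenbasis d A u l" "\<And>i j. i \<le> j \<Longrightarrow> j < d \<Longrightarrow> l j \<le> l i"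
    and B: "eigenbasis d B v m" "\<And>i j. i \<le> j \<Longrightarrow> j < d \<Longrightarrow> m j \<le> m i"
    and C: "eigenbasis d (A + B) w c" "\<And>i j. i \<le> j \<Longrightarrow> j < d \<Longrightarrow> c j \<le> c i"
    and J: "J \<subseteq> {..<d}"
  shows "(\<Sum>i\<in>J. l i + m (d - 1 - i)) \<le> (\<Sum>i<card J. c i)"
proof (cases "J = {}")
  case False
  define j where "j = card J"
  have fin: "finite J" using J by (rule finite_subset) simp
  have j: "0 < j" "j \<le> d"
    using False fin card_mono[OF _ J] by (auto simp: j_def card_gt_0_iff)
  define t where "t = c (j - 1)"
  have c_ge: "t \<le> c i" if "i < j" for i using C(2)[of i "j - 1"] that j by (simp add: t_def)
  have c_le: "c i \<le> t" if "j \<le> i" "i < d" for i using C(2)[of "j - 1" i] that j by (simp add: t_def)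
  define P where "P = frame_op d (diagonal_frame w (\<lambda>i. c i - t) j)"
  have P: "eigenbasis d P w (\<lambda>i. if i < j then c i - t else 0)"
    unfolding P_def using eigenbasis_diagonal_frame[OF C(1) j(2)] c_ge by simp
  have Pset: "set (diagonal_frame w (\<lambda>i. c i - t) j) \<subseteq> carrier_vec d"
    by (rule diagonal_frame_carrier[OF C(1) j(2)])
  note carr = eigenbasisD(1)[OF A(1)] eigenbasisD(1)[OF B(1)] eigenbasisD(1)[OF P]
  define B' where "B' = B - P"
  have B'c: "B' \<in> carrier_mat d d" unfolding B'_def by (rule minus_carrier_mat[OF carr(3)])
  have B_eq: "B = B' + P" using carr by (intro eq_matI) (auto simp: B'_def)
  have "hermitian d B'"
  proof -
    have "B' $$ (p, q) = cnj (B' $$ (q, p))" if "p < d" "q < d" for p q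
    proof -
      have "B $$ (p, q) = cnj (B $$ (q, p))" "P $$ (p, q) = cnj (P $$ (q, p))"
        using eigenbasis_hermitian[OF B(1)] eigenbasis_hermitian[OF P] that unfolding hermitian_def by blast+
      then show ?thesis using that carr by (simp add: B'_def)
    qed
    then show ?thesis using B'c unfolding hermitian_def by blast
  qed
  then obtain v' m' where B': "eigenbasis d B' v' m'" "\<And>i j. i \<le> j \<Longrightarrow> j < d \<Longrightarrow> m' j \<le> m' i"
    using hermitian_decreasing_eigenbasis by blast
  have q: "qform A x + qform B' x + qform P x = qform (A + B) x"
    "qform B x = qform B' x + qform P x" if "x \<in> carrier_vec d" for x
    using qform_add[OF carr(1,2) that] qform_add[OF B'c carr(3) that] by (simp_all flip: B_eq)
  have mono: "m' i \<le> m i" if "i < d" for i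
  proof (rule weyl_monotone[OF B' B _ that])
    fix x :: "complex vec" assume x: "x \<in> carrier_vec d"
    have "0 \<le> qform P x" unfolding P_def qform_frame_op[OF Pset x] by (auto intro!: sum_list_nonneg)
    then show "qform B' x \<le> qform B x" using q(2)[OF x] by simp
  qed
  have opp: "l i + m' (d - 1 - i) \<le> t" if "i < d" for i
  proof (rule weyl_opposite[OF A B' _ that])
    fix x :: "complex vec" assume x: "x \<in> carrier_vec d"
    have "qform (A + B) x - qform P x
        = (\<Sum>k<d. (c k - (if k < j then c k - t else 0)) * (cmod (x \<bullet>c w k))\<^sup>2)"
      by (simp add: qform_eigenbasis[OF C(1) x] qform_eigenbasis[OF P x] left_diff_distrib sum_subtractf)
    also have "\<dots> \<le> (\<Sum>k<d. t * (cmod (x \<bullet>c w k))\<^sup>2)"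
      using c_le by (intro sum_mono mult_right_mono) auto
    also have "\<dots> = t * sq_norm x"
      using parseval[OF eigenbasisD(2,3)[OF P] x] by (simp add: sum_distrib_left)
    finally show "qform A x + qform B' x \<le> t * sq_norm x" using q(1)[OF x] by simp
  qed
  have "(\<Sum>i\<in>J. l i + m (d - 1 - i)) \<le> (\<Sum>i\<in>J. t + (m (d - 1 - i) - m' (d - 1 - i)))"
    using opp J by (intro sum_mono) (smt (verit) lessThan_iff subsetD)
  also have "\<dots> = j * t + (\<Sum>i\<in>J. m (d - 1 - i) - m' (d - 1 - i))"
    by (simp add: sum.distrib j_def)
  also have "(\<Sum>i\<in>J. m (d - 1 - i) - m' (d - 1 - i)) \<le> (\<Sum>i<d. m (d - 1 - i) - m' (d - 1 - i))"
    using mono J by (intro sum_mono2) auto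
  also have "\<dots> = (\<Sum>i<d. m i - m' i)"
    by (rule sum.reindex_bij_witness[of _ "\<lambda>i. d - 1 - i" "\<lambda>i. d - 1 - i"]) auto
  also have "\<dots> = (\<Sum>i<d. if i < j then c i - t else 0)"
  proof -
    have "complex_of_real (\<Sum>i<d. m i) = complex_of_real (\<Sum>i<d. m' i) + complex_of_real (\<Sum>i<d. if i < j then c i - t else 0)"
      using trace_add[OF B'c carr(3)] trace_eigenbasis[OF B(1)] trace_eigenbasis[OF B'(1)] trace_eigenbasis[OF P]
      by (simp flip: B_eq)
    then have "(\<Sum>i<d. m i) = (\<Sum>i<d. m' i) + (\<Sum>i<d. if i < j then c i - t else 0)"
      by (simp only: of_real_add[symmetric] of_real_eq_iff)
    then show ?thesis by (simp add: sum_subtractf)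
  qed
  also have "\<dots> = (\<Sum>i<j. c i - t)"
    using j by (intro sum.mono_neutral_cong_right) auto
  finally show ?thesis by (simp add: sum_subtractf j_def)
qed simp

text \<open>
  The easy half of the Schur--Horn theorem. The frame operator of the first \<open>j\<close> vectors has rank at most \<open>j\<close> and lies below that of the
  whole frame, so its trace, the sum of the squared norms, involves only \<open>j\<close> eigenvalues
  and each of them is at most the corresponding eigenvalue of the whole.
\<close>

theorem norms_majorized_by_spectrum:
  assumes G: "set G \<subseteq> carrier_vec d"
    and C: "eigenbasis d (frame_op d G) w c" "\<And>i j. i \<le> j \<Longrightarrow> j < d \<Longrightarrow> c j \<le> c i"
  shows "(\<Sum>g\<leftarrow>take j G. sq_norm g) \<le> (\<Sum>i<min j d. c i)"
proof -
  define H where "H = take j G"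
  have H: "set H \<subseteq> carrier_vec d" using G set_take_subset[of j G] by (auto simp: H_def)
  obtain u l where A: "eigenbasis d (frame_op d H) u l" "\<And>i j. i \<le> j \<Longrightarrow> j < d \<Longrightarrow> l j \<le> l i"
    using hermitian_decreasing_eigenbasis[OF hermitian_frame_op[OF H]] by blast
  \<comment> \<open>Conditions beyond the \<open>j\<close> vectors are filled up with the zero vector.\<close>
  have low_rank: "l q \<le> 0" if "j \<le> q" "q < d" for q
  proof -
    define h where "h i = (if i < length H then H ! i else 0\<^sub>v d)" for i
    have "h i \<in> carrier_vec d" for i using H by (auto simp: h_def)
    then obtain x where x: "x \<in> carrier_vec d" "0 < sq_norm x" "\<And>i. i < q \<Longrightarrow> x \<bullet>c h i = 0"
      "l q * sq_norm x \<le> qform (frame_op d H) x"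
      using exists_vector_large_qform[OF A \<open>q < d\<close>, of h] by blast
    have "x \<bullet>c g = 0" if g: "g \<in> set H" for g
    proof -
      obtain i where "i < length H" "g = H ! i" using g by (metis in_set_conv_nth)
      then show ?thesis using x(3)[of i] \<open>j \<le> q\<close> by (simp add: H_def h_def)
    qed
    then have "(\<Sum>g\<leftarrow>H. (cmod (x \<bullet>c g))\<^sup>2) = (\<Sum>g\<leftarrow>H. 0)"
      by (intro arg_cong[of _ _ sum_list] map_cong) auto
    then have "qform (frame_op d H) x = 0" using qform_frame_op[OF H x(1)] by simp
    then show ?thesis using x(2,4) by (simp add: mult_le_0_iff)
  qed
  have mono: "l q \<le> c q" if "q < d" for q
  proof (rule weyl_monotone[OF A C _ that])
    fix x :: "complex vec" assume x: "x \<in> carrier_vec d"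
    have "(\<Sum>g\<leftarrow>G. (cmod (x \<bullet>c g))\<^sup>2) = (\<Sum>g\<leftarrow>H @ drop j G. (cmod (x \<bullet>c g))\<^sup>2)"
      by (simp add: H_def)
    then show "qform (frame_op d H) x \<le> qform (frame_op d G) x"
      unfolding qform_frame_op[OF H x] qform_frame_op[OF G x] by (auto intro!: sum_list_nonneg)
  qed
  have "(\<Sum>g\<leftarrow>H. sq_norm g) = (\<Sum>i<d. l i)"
    using trace_frame_op[OF H] trace_eigenbasis[OF A(1)] by (simp only: of_real_eq_iff)
  also have "\<dots> \<le> (\<Sum>i<d. if i < min j d then c i else 0)"
    using low_rank mono by (intro sum_mono) (simp add: not_less)
  also have "\<dots> = (\<Sum>i<min j d. c i)"
    by (intro sum.mono_neutral_cong_right) auto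
  finally show ?thesis by (simp add: H_def)
qed

lemma rank_frame_op_le:
  assumes "set H \<subseteq> carrier_vec d"
  shows "vec_space.rank d (frame_op d H) \<le> length H"
proof -
  interpret vec_space "TYPE(complex)" d .
  show ?thesis using assms
  proof (induction H)
    case (Cons g H)
    then have g: "g \<in> carrier_vec d" and H: "frame_op d H \<in> carrier_mat d d"
      by (auto intro: frame_op_carrier)
    have "rank (rank_one g g) \<le> 1"
      using g by (intro rank_le_1_product_entries[of _ d "\<lambda>i. g $ i" "\<lambda>i. cnj (g $ i)"])
        (auto simp: rank_one_def)
    then show ?case
      using rank_subadditive[OF rank_one_carrier[OF g] H] Cons by (simp add: frame_op_Cons)
  qed (simp add: rank_0I)
qed

text \<open>
  If the eigenvalues vanish from index \<open>q\<close> on, the operator is also the frame operator of \<open>q\<close> scaled eigenvectors.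
\<close>

lemma rank_le_if_eigenvalue_0:
  assumes "eigenbasis d (frame_op d F) u l" "set F \<subseteq> carrier_vec d"
    "\<And>i j. i \<le> j \<Longrightarrow> j < d \<Longrightarrow> l j \<le> l i" and "q < d" "l q = 0"
  shows "vec_space.rank d (frame_op d F) \<le> q"
proof -
  have nonneg: "0 \<le> l i" if "i < d" for i using eigenbasis_frame_op_nonneg[OF assms(1,2) that] .
  have "frame_op d F = frame_op d (diagonal_frame u l q)"
  proof (rule eigenbasis_unique_matrix[OF assms(1)])
    show "eigenbasis d (frame_op d (diagonal_frame u l q)) u (\<lambda>i. if i < q then l i else 0)"
      using nonneg assms by (intro eigenbasis_diagonal_frame[OF assms(1)]) auto
    show "l i = (if i < q then l i else 0)" if "i < d" for i
      using assms(3)[of q i] nonneg[OF that] assms(5) that by (cases "i < q") auto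
  qed
  then show ?thesis
    using rank_frame_op_le[OF diagonal_frame_carrier[OF assms(1), of q l]] \<open>q < d\<close>
    by (simp add: diagonal_frame_def)
qed

text \<open>
  Rotating the pair \<open>(g, h)\<close> by an angle does not change its frame operator. A quarter turn brings \<open>h\<close>
  into the place of \<open>g\<close>, so by continuity the first squared norm takes every value between
  the two; the second one follows from the trace.
\<close>

lemma rotate_pair:
  assumes g: "g \<in> carrier_vec d" and h: "h \<in> carrier_vec d"
    and s: "sq_norm h \<le> s" "s \<le> sq_norm g"
  obtains g' h' where "g' \<in> carrier_vec d" "h' \<in> carrier_vec d" "sq_norm g' = s"
    "sq_norm h' = sq_norm g + sq_norm h - s" "frame_op d [g', h'] = frame_op d [g, h]"
proof -
  define rot where "rot \<theta> = complex_of_real (cos \<theta>) \<cdot>\<^sub>v g + complex_of_real (sin \<theta>) \<cdot>\<^sub>v h" for \<theta>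
  have rot: "rot \<theta> \<in> carrier_vec d" for \<theta> using g h by (simp add: rot_def)
  have norm_rot: "sq_norm (rot \<theta>) =
      (\<Sum>i<d. (cmod (complex_of_real (cos \<theta>) * g $ i + complex_of_real (sin \<theta>) * h $ i))\<^sup>2)" for \<theta>
    using g h by (simp add: sq_norm_sum[OF rot]) (simp add: rot_def)
  have "isCont (\<lambda>\<theta>. sq_norm (rot \<theta>)) \<theta>" for \<theta>
    unfolding norm_rot by (intro continuous_intros)
  moreover have "sq_norm (rot (pi / 2)) \<le> s" "s \<le> sq_norm (rot 0)"
    using s unfolding norm_rot by (simp_all add: sq_norm_sum[OF g] sq_norm_sum[OF h])
  ultimately obtain \<theta> where \<theta>: "sq_norm (rot \<theta>) = s"
    using IVT2[of "\<lambda>\<theta>. sq_norm (rot \<theta>)" "pi / 2" s 0] by auto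
  define h' where "h' = complex_of_real (- sin \<theta>) \<cdot>\<^sub>v g + complex_of_real (cos \<theta>) \<cdot>\<^sub>v h"
  have h': "h' \<in> carrier_vec d" using g h by (simp add: h'_def)
  have "cos \<theta> * cos \<theta> + sin \<theta> * sin \<theta> = 1"
    using sin_cos_squared_add2[of \<theta>] by (simp add: power2_eq_square)
  then have one: "complex_of_real (cos \<theta>) * complex_of_real (cos \<theta>) +
      complex_of_real (sin \<theta>) * complex_of_real (sin \<theta>) = 1"
    by (metis of_real_1 of_real_add of_real_mult)
  have S: "frame_op d [rot \<theta>, h'] = frame_op d [g, h]"
  proof (intro eq_matI)
    fix i j assume "i < dim_row (frame_op d [g, h])" "j < dim_col (frame_op d [g, h])"
    then have ij: "i < d" "j < d" using frame_op_carrier[of "[g, h]" d] g h by auto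
    define c s where "c = complex_of_real (cos \<theta>)" and "s = complex_of_real (sin \<theta>)"
    have "frame_op d [rot \<theta>, h'] $$ (i, j) =
      (c * g $ i + s * h $ i) * (c * cnj (g $ j) + s * cnj (h $ j)) +
      (c * h $ i - s * g $ i) * (c * cnj (h $ j) - s * cnj (g $ j))"
      using ij g h rot[of \<theta>] h' by (subst frame_op_entry) (auto simp: rot_def h'_def c_def s_def)
    also have "\<dots> = (c * c + s * s) * (g $ i * cnj (g $ j) + h $ i * cnj (h $ j))"
      by (simp add: algebra_simps)
    also have "\<dots> = frame_op d [g, h] $$ (i, j)"
      using ij g h one by (subst frame_op_entry) (auto simp: c_def s_def)
    finally show "frame_op d [rot \<theta>, h'] $$ (i, j) = frame_op d [g, h] $$ (i, j)" .
  qed (use frame_op_carrier[of "[g, h]" d] frame_op_carrier[of "[rot \<theta>, h']" d] g h h' rot[of \<theta>] in auto)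
  have "complex_of_real (sq_norm (rot \<theta>) + sq_norm h') = complex_of_real (sq_norm g + sq_norm h)"
    using trace_frame_op[of "[rot \<theta>, h']" d] trace_frame_op[of "[g, h]" d] g h h' rot[of \<theta>] S by simp
  then have "sq_norm h' = sq_norm g + sq_norm h - s" using \<theta> by (simp only: of_real_eq_iff)
  then show ?thesis using that rot h' \<theta> S by blast
qed

text \<open>
  The hard half of the Schur--Horn theorem: frames with a fixed frame operator admit every averaging of their
  squared norms, because each step is a rotation of two vectors.
\<close>

theorem frame_norms_averaging:
  assumes "averaging M N"
    and "\<exists>G. set G \<subseteq> carrier_vec d \<and> mset (map sq_norm G) = M \<and> frame_op d G = S"
  shows "\<exists>G. set G \<subseteq> carrier_vec d \<and> mset (map sq_norm G) = N \<and> frame_op d G = S"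
  using assms
proof (induction rule: averaging.induct)
  case (averaging_step M u v N s)
  then obtain G where G: "set G \<subseteq> carrier_vec d" "image_mset sq_norm (mset G) = add_mset u (add_mset v N)"
    "frame_op d G = S" by auto
  then obtain g R where R: "mset G = add_mset g R" "sq_norm g = u" "image_mset sq_norm R = add_mset v N"
    using msed_map_invR by metis
  then obtain h R' where R': "R = add_mset h R'" "sq_norm h = v" "image_mset sq_norm R' = N"
    using msed_map_invR by metis
  obtain K where K: "mset K = R'" using ex_mset by blast
  have perm: "mset (g # h # K) = mset G" by (simp add: R R' K)
  have gh: "g \<in> carrier_vec d" "h \<in> carrier_vec d" "set K \<subseteq> carrier_vec d"
    using G(1) mset_eq_setD[OF perm] by auto
  obtain g' h' where g': "g' \<in> carrier_vec d" "h' \<in> carrier_vec d" "sq_norm g' = s"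
    "sq_norm h' = u + v - s" "frame_op d [g', h'] = frame_op d [g, h]"
    using rotate_pair[OF gh(1,2), of s] averaging_step.hyps R R' by metis
  have "frame_op d (g' # h' # K) = frame_op d (g # h # K)"
    using frame_op_append[of "[g', h']" d K] frame_op_append[of "[g, h]" d K] g' gh by simp
  also have "\<dots> = S" using frame_op_mset_cong[OF perm G(1)] G(3) by simp
  finally show ?case using g' gh K R' by (intro exI[of _ "g' # h' # K"]) auto
qed

section \<open>A convex optimization problem\<close>

lemma strictly_convex_slopes:
  assumes f: "strictly_convex_nonneg f" and "0 \<le> a" "a < b" "b < c"
  shows "(f b - f a) / (b - a) < (f c - f b) / (c - b)"
proof -
  define t where "t = (b - a) / (c - a)"
  have t: "0 < t" "t < 1" using assms by (auto simp: t_def)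
  have tc: "t * (c - a) = b - a" using assms by (simp add: t_def)
  have b: "b = (1 - t) * a + t * c" using tc by (simp add: algebra_simps)
  have "f b < (1 - t) * f a + t * f c"
    using f t assms(2-) unfolding strictly_convex_nonneg_def b by simp
  then have "(c - a) * f b < (c - a) * ((1 - t) * f a + t * f c)" using assms by simp
  also have "\<dots> = ((c - a) - t * (c - a)) * f a + (t * (c - a)) * f c"
    by (simp add: algebra_simps)
  also have "\<dots> = (c - b) * f a + (b - a) * f c" unfolding tc by simp
  finally show ?thesis using assms by (simp add: field_simps)
qed

text \<open>
  Lower semicontinuity at every nonnegative point, relative to the nonnegative reals.
\<close>

definition lsc_nonneg :: "(real \<Rightarrow> real) \<Rightarrow> bool" where
  "lsc_nonneg g \<longleftrightarrow> (\<forall>x\<ge>0. \<forall>e>0. \<exists>\<delta>>0. \<forall>y\<ge>0. \<bar>y - x\<bar> < \<delta> \<longrightarrow> g x - e < g y)"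

text \<open>
  The chords on the two sides of \<open>x\<close> give supporting lines, so near \<open>x\<close> the function drops at most linearly.
\<close>

lemma lsc_at_pos:
  assumes g: "strictly_convex_nonneg g" and "0 < x" "0 < e"
  shows "\<exists>\<delta>>0. \<forall>y\<ge>0. \<bar>y - x\<bar> < \<delta> \<longrightarrow> g x - e < g y"
proof -
  define k1 where "k1 = (g x - g (x / 2)) / (x - x / 2)"
  define k2 where "k2 = (g (2 * x) - g x) / (2 * x - x)"
  define K where "K = \<bar>k1\<bar> + \<bar>k2\<bar> + 1"
  have "g x - g y \<le> K * \<bar>y - x\<bar>" if "0 \<le> y" for y
  proof -
    consider "y < x" | "y = x" | "x < y" by linarith
    then show ?thesis
    proof cases
      case 1
      then have "(g x - g y) / (x - y) < k2"
        using strictly_convex_slopes[OF g that 1, of "2 * x"] \<open>0 < x\<close> by (simp add: k2_def)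
      then have "g x - g y < k2 * (x - y)" using 1 by (simp add: field_simps)
      also have "\<dots> \<le> K * (x - y)" using 1 by (intro mult_right_mono) (auto simp: K_def)
      finally show ?thesis using 1 by simp
    next
      case 3
      then have "k1 < (g y - g x) / (y - x)"
        using strictly_convex_slopes[OF g _ _ 3, of "x / 2"] \<open>0 < x\<close> by (simp add: k1_def)
      then have "g x - g y < (- k1) * (y - x)" using 3 by (simp add: field_simps)
      also have "\<dots> \<le> K * (y - x)" using 3 by (intro mult_right_mono) (auto simp: K_def)
      finally show ?thesis using 3 by simp
    qed simp
  qed
  moreover have "K * \<bar>y - x\<bar> < e" if "\<bar>y - x\<bar> < e / K" for y
    using that by (simp add: K_def field_simps)
  ultimately show ?thesis
    using \<open>0 < e\<close> by (intro exI[of _ "e / K"]) (fastforce simp: K_def)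
qed

text \<open>
  A convex function on the nonnegative reals can only fail to be lower semicontinuous at 0, where it may jump up. The value at 0 is
  replaced by the limit from the right. As the slopes of chords increase, this limit is the supremum of the values at 0 of
  the lines through two points \<open>(a, f a)\<close> and \<open>(b, f b)\<close> with \<open>0 < a < b\<close>; in this form convexity of the
  new function and its semicontinuity at 0 are direct.
\<close>

lemma lsc_regularization:
  assumes f: "strictly_convex_nonneg f"
  obtains g where "strictly_convex_nonneg g" "lsc_nonneg g" "\<And>x. 0 < x \<Longrightarrow> g x = f x" "g 0 \<le> f 0"
proof -
  define line where "line a b = f a - a * ((f b - f a) / (b - a))" for a b
  define Q where "Q = {line a b | a b. 0 < a \<and> a < b}"
  define L where "L = Sup Q"
  define g where "g = f(0 := L)"
  have ub: "q \<le> f 0" if q: "q \<in> Q" for q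
  proof -
    obtain a b where ab: "0 < a" "a < b" "q = line a b" using q by (auto simp: Q_def)
    then have "(f a - f 0) / a < (f b - f a) / (b - a)"
      using strictly_convex_slopes[OF f, of 0 a b] by simp
    then have "f a - f 0 < a * ((f b - f a) / (b - a))"
      using ab by (simp add: pos_divide_less_eq mult.commute)
    then show ?thesis using ab by (simp add: line_def)
  qed
  have "line 1 2 \<in> Q" unfolding Q_def by (rule CollectI, intro exI[of _ 1] exI[of _ 2]) simp
  then have ne: "Q \<noteq> {}" by blast
  have bdd: "bdd_above Q" by (rule bdd_aboveI[of _ "f 0"], rule ub)
  have L_upper: "line a b \<le> L" if "0 < a" "a < b" for a b
    unfolding L_def using that by (intro cSup_upper bdd) (auto simp: Q_def)
  have L_strict: "line a b < L" if "0 < a" "a < b" for a b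
  proof -
    define k where "k = (f a - f (a / 2)) / (a - a / 2)"
    have "k < (f b - f a) / (b - a)"
      using strictly_convex_slopes[OF f, of "a / 2" a b] that by (simp add: k_def)
    then have "a * k < a * ((f b - f a) / (b - a))" using that(1) by (rule mult_strict_left_mono)
    then have "line a b < f a - a * k" by (simp add: line_def)
    also have "\<dots> = line (a / 2) a" using that by (simp add: line_def k_def field_simps)
    also have "\<dots> \<le> L" using that by (intro L_upper) auto
    finally show ?thesis .
  qed
  \<comment> \<open>\<open>line a b\<close> increases strictly when \<open>a\<close> and \<open>b\<close> move towards 0, so the supremum is not attained
    and the chords that start at 0 are strict as well.\<close>
  have chord0: "f (t * y) < (1 - t) * L + t * f y" if "0 < y" "0 < t" "t < 1" for t y
  proof -
    have "line (t * y) y < L" using that by (intro L_strict) auto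
    moreover have "line (t * y) y = (f (t * y) - t * f y) / (1 - t)"
    proof -
      have "t * y * ((f y - f (t * y)) / (y - t * y)) = t * (f y - f (t * y)) / (1 - t)"
        using that by (simp add: divide_simps) (simp add: algebra_simps)
      then show ?thesis using that unfolding line_def by (simp add: field_simps)
    qed
    ultimately have "f (t * y) - t * f y < L * (1 - t)" using that by (simp add: pos_divide_less_eq)
    then show ?thesis by (simp add: algebra_simps)
  qed
  have "strictly_convex_nonneg g"
    unfolding strictly_convex_nonneg_def
  proof (intro allI impI)
    fix x y t :: real assume xy: "0 \<le> x" "0 \<le> y" and t: "x \<noteq> y \<and> 0 < t \<and> t < 1"
    consider "x = 0" "0 < y" | "y = 0" "0 < x" | "0 < x" "0 < y" using xy t by linarith
    then show "g ((1 - t) * x + t * y) < (1 - t) * g x + t * g y"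
    proof cases
      case 1
      then show ?thesis using chord0[of y t] t by (simp add: g_def)
    next
      case 2
      then show ?thesis using chord0[of x "1 - t"] t by (simp add: g_def)
    next
      case 3
      then have "0 < (1 - t) * x + t * y" using t by (simp add: add_pos_pos)
      then show ?thesis using 3 t f xy unfolding strictly_convex_nonneg_def g_def by simp
    qed
  qed
  moreover have "lsc_nonneg g"
    unfolding lsc_nonneg_def
  proof (intro allI impI)
    fix x e :: real assume "0 \<le> x" "0 < e"
    show "\<exists>\<delta>>0. \<forall>y\<ge>0. \<bar>y - x\<bar> < \<delta> \<longrightarrow> g x - e < g y"
    proof (cases "x = 0")
      case False
      then show ?thesis
        using lsc_at_pos[OF \<open>strictly_convex_nonneg g\<close>, of x e] \<open>0 \<le> x\<close> \<open>0 < e\<close> by simp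
    next
      case True
      obtain q where "q \<in> Q" "L - e / 2 < q"
        using less_cSup_iff[OF ne bdd, of "L - e / 2"] \<open>0 < e\<close> by (auto simp: L_def)
      then obtain a b where ab: "0 < a" "a < b" "L - e / 2 < line a b" by (auto simp: Q_def)
      define k where "k = (f b - f a) / (b - a)"
      define \<delta> where "\<delta> = min a (e / (2 * (\<bar>k\<bar> + 1)))"
      have "L - e < g y" if "0 \<le> y" "y < \<delta>" for y
      proof (cases "y = 0")
        case False
        then have y: "0 < y" "y < a" using that by (auto simp: \<delta>_def)
        have "y * (2 * (\<bar>k\<bar> + 1)) < e" using that by (simp add: \<delta>_def pos_less_divide_eq)
        then have "2 * (y * \<bar>k\<bar>) < e" using y by (simp add: algebra_simps)
        moreover have "- (y * k) \<le> y * \<bar>k\<bar>" using y by (metis abs_ge_minus_self abs_mult abs_of_pos)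
        moreover have "(f a - f y) / (a - y) < k"
          using strictly_convex_slopes[OF f _ y(2) ab(2)] y by (simp add: k_def)
        then have "f a - f y < k * (a - y)" using y by (simp add: pos_divide_less_eq)
        ultimately have "L - e < f y" using ab(3) by (simp add: line_def k_def[symmetric] algebra_simps)
        then show ?thesis using False by (simp add: g_def)
      qed (use \<open>0 < e\<close> in \<open>simp add: g_def\<close>)
      moreover have "0 < \<delta>" using ab \<open>0 < e\<close> by (simp add: \<delta>_def)
      ultimately show ?thesis using True by (intro exI[of _ \<delta>]) (auto simp: g_def)
    qed
  qed
  moreover have "L \<le> f 0" unfolding L_def using ub ne by (intro cSup_least) auto
  ultimately show ?thesis using that[of g] by (simp add: g_def)
qed

lemma convergent_coordinates_subsequence:
  fixes x :: "nat \<Rightarrow> nat \<Rightarrow> real"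
  assumes "\<And>n i. i < d \<Longrightarrow> 0 \<le> x n i \<and> x n i \<le> M"
  shows "\<exists>r \<mu>. strict_mono r \<and> (\<forall>i<d. (\<lambda>n. x (r n) i) \<longlonglongrightarrow> \<mu> i)"
  using assms
proof (induction d)
  case 0
  then show ?case by (intro exI[of _ id]) (auto simp: strict_mono_def)
next
  case (Suc d)
  then obtain r \<mu> where r: "strict_mono r" "\<forall>i<d. (\<lambda>n. x (r n) i) \<longlonglongrightarrow> \<mu> i" by fastforce
  obtain s where s: "strict_mono s" "monoseq (\<lambda>n. x (r (s n)) d)"
    using seq_monosub[of "\<lambda>n. x (r n) d"] by auto
  have "norm (x (r (s n)) d) \<le> M" for n using Suc.prems[of d "r (s n)"] by simp
  then have "Bseq (\<lambda>n. x (r (s n)) d)" by (rule BseqI')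
  then obtain c where c: "(\<lambda>n. x (r (s n)) d) \<longlonglongrightarrow> c"
    using Bseq_monoseq_convergent s(2) unfolding convergent_def by blast
  have "(\<lambda>n. x ((r \<circ> s) n) i) \<longlonglongrightarrow> (\<mu>(d := c)) i" if "i < Suc d" for i
    using that r(2) c LIMSEQ_subseq_LIMSEQ[OF _ s(1), of "\<lambda>n. x (r n) i" "\<mu> i"]
    by (cases "i = d") (auto simp: o_def)
  then show ?case using strict_mono_o[OF r(1) s(1)] by blast
qed

text \<open>
  The polytope of increasing nonnegative vectors that majorize a given vector, for \<open>A j\<close> the sum of its \<open>j\<close>
  largest entries and \<open>k\<close> its length. For \<open>j > d\<close> the truncated difference \<open>d - j\<close> is 0, so that the
  condition compares \<open>A j\<close> with the full sum.
\<close>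

definition feasible :: "nat \<Rightarrow> nat \<Rightarrow> (nat \<Rightarrow> real) \<Rightarrow> (nat \<Rightarrow> real) \<Rightarrow> bool" where
  "feasible d k A \<mu> \<longleftrightarrow> (\<forall>i<d. 0 \<le> \<mu> i) \<and> (\<forall>i. Suc i < d \<longrightarrow> \<mu> i \<le> \<mu> (Suc i)) \<and>
     (\<forall>j. A j \<le> (\<Sum>i=d-j..<d. \<mu> i)) \<and> (\<Sum>i<d. \<mu> i) = A k"

definition shifted_sum :: "nat \<Rightarrow> (real \<Rightarrow> real) \<Rightarrow> (nat \<Rightarrow> real) \<Rightarrow> (nat \<Rightarrow> real) \<Rightarrow> real" where
  "shifted_sum d g l \<mu> = (\<Sum>i<d. g (l i + \<mu> i))"

lemma feasible_mono:
  assumes "feasible d k A \<mu>" "i \<le> j" "j < d"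
  shows "\<mu> i \<le> \<mu> j"
  using assms(2,3)
proof (induction j rule: dec_induct)
  case (step n)
  then have "\<mu> n \<le> \<mu> (Suc n)" using assms(1) by (simp add: feasible_def)
  then show ?case using step by simp
qed simp

lemma feasible_le_total:
  assumes "feasible d k A \<mu>" "i < d"
  shows "\<mu> i \<le> A k"
proof -
  have "\<mu> i \<le> (\<Sum>i<d. \<mu> i)" using assms by (intro member_le_sum) (auto simp: feasible_def)
  then show ?thesis using assms by (simp add: feasible_def)
qed

lemma feasible_midpoint:
  assumes "feasible d k A \<mu>" "feasible d k A \<gamma>"
  shows "feasible d k A (\<lambda>i. (\<mu> i + \<gamma> i) / 2)"
proof -
  have half: "(\<Sum>i\<in>S. (\<mu> i + \<gamma> i) / 2) = ((\<Sum>i\<in>S. \<mu> i) + (\<Sum>i\<in>S. \<gamma> i)) / 2" for S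
    by (simp add: sum_divide_distrib[symmetric] sum.distrib)
  have "A j \<le> ((\<Sum>i=d-j..<d. \<mu> i) + (\<Sum>i=d-j..<d. \<gamma> i)) / 2" for j
  proof -
    have "A j \<le> (\<Sum>i=d-j..<d. \<mu> i)" "A j \<le> (\<Sum>i=d-j..<d. \<gamma> i)"
      using assms by (simp_all add: feasible_def)
    then show ?thesis by simp
  qed
  moreover have "(\<mu> i + \<gamma> i) / 2 \<le> (\<mu> (Suc i) + \<gamma> (Suc i)) / 2" if "Suc i < d" for i
    using assms that unfolding feasible_def by (intro divide_right_mono add_mono) auto
  ultimately show ?thesis using assms unfolding feasible_def half by auto
qed

lemma feasible_limit:
  assumes "\<And>n. feasible d k A (x n)" and lim: "\<And>i. i < d \<Longrightarrow> (\<lambda>n. x n i) \<longlonglongrightarrow> \<mu> i"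
  shows "feasible d k A \<mu>"
proof -
  have "0 \<le> \<mu> i" if "i < d" for i
    using LIMSEQ_le_const[OF lim[OF that], of 0] assms(1) that by (auto simp: feasible_def)
  moreover have "\<mu> i \<le> \<mu> (Suc i)" if "Suc i < d" for i
    using LIMSEQ_le[OF lim lim, of i "Suc i"] assms(1) that by (auto simp: feasible_def)
  moreover have "A j \<le> (\<Sum>i=d-j..<d. \<mu> i)" for j
  proof (rule LIMSEQ_le_const)
    show "(\<lambda>n. \<Sum>i=d-j..<d. x n i) \<longlonglongrightarrow> (\<Sum>i=d-j..<d. \<mu> i)" by (intro tendsto_sum lim) auto
    show "\<exists>N. \<forall>n\<ge>N. A j \<le> (\<Sum>i=d-j..<d. x n i)" using assms(1) by (auto simp: feasible_def)
  qed
  moreover have "(\<Sum>i<d. \<mu> i) = A k"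
  proof (rule LIMSEQ_unique)
    show "(\<lambda>n. \<Sum>i<d. x n i) \<longlonglongrightarrow> (\<Sum>i<d. \<mu> i)" by (intro tendsto_sum lim) auto
    show "(\<lambda>n. \<Sum>i<d. x n i) \<longlonglongrightarrow> A k" using assms(1) by (simp add: feasible_def)
  qed
  ultimately show ?thesis by (simp add: feasible_def)
qed

text \<open>
  A minimizing sequence has a subsequence that converges in every coordinate, and lower semicontinuity bounds
  the value at the limit.
\<close>

lemma exists_feasible_minimizer:
  assumes ne: "feasible d k A \<gamma>0" and g: "lsc_nonneg g" "\<And>y. 0 \<le> y \<Longrightarrow> b \<le> g y"
    and l: "\<And>i. i < d \<Longrightarrow> 0 \<le> l i"
  shows "\<exists>\<mu>. feasible d k A \<mu> \<and> (\<forall>\<gamma>. feasible d k A \<gamma> \<longrightarrow> shifted_sum d g l \<mu> \<le> shifted_sum d g l \<gamma>)"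
proof -
  define V where "V = shifted_sum d g l ` {\<gamma>. feasible d k A \<gamma>}"
  have "d * b \<le> v" if "v \<in> V" for v
  proof -
    obtain \<gamma> where \<gamma>: "feasible d k A \<gamma>" "v = (\<Sum>i<d. g (l i + \<gamma> i))"
      using \<open>v \<in> V\<close> by (auto simp: V_def shifted_sum_def)
    then have "(\<Sum>i<d. b) \<le> v" using g(2) l unfolding \<gamma>(2) by (intro sum_mono) (auto simp: feasible_def)
    then show ?thesis by simp
  qed
  then have bdd: "bdd_below V" by (rule bdd_belowI)
  have neV: "V \<noteq> {}" using ne by (auto simp: V_def)
  have "\<exists>\<gamma>. feasible d k A \<gamma> \<and> shifted_sum d g l \<gamma> < Inf V + 1 / real (Suc n)" for n
  proof -
    have "Inf V < Inf V + 1 / real (Suc n)" by simp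
    then obtain v where "v \<in> V" "v < Inf V + 1 / real (Suc n)"
      using cInf_less_iff[OF neV bdd] by blast
    then show ?thesis unfolding V_def by blast
  qed
  then obtain x where x: "\<And>n. feasible d k A (x n)"
    "\<And>n. shifted_sum d g l (x n) < Inf V + 1 / real (Suc n)" by metis
  have bound: "0 \<le> x n i \<and> x n i \<le> A k" if "i < d" for n i
    using x(1)[of n] feasible_le_total[OF x(1) that] that by (auto simp: feasible_def)
  obtain r \<mu> where r: "strict_mono r" "\<And>i. i < d \<Longrightarrow> (\<lambda>n. x (r n) i) \<longlonglongrightarrow> \<mu> i"
    using convergent_coordinates_subsequence[of d x "A k"] bound by blast
  have \<mu>: "feasible d k A \<mu>" using feasible_limit[of d k A "\<lambda>n. x (r n)"] x(1) r(2) by blast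
  have "shifted_sum d g l \<mu> \<le> Inf V"
  proof (rule field_le_epsilon)
    fix e :: real assume "0 < e"
    define e' where "e' = e / (real d + 1)"
    have e': "0 < e'" using \<open>0 < e\<close> by (simp add: e'_def)
    have "\<forall>\<^sub>F n in sequentially. g (l i + \<mu> i) - e' < g (l i + x (r n) i)" if "i < d" for i
    proof -
      have "0 \<le> l i + \<mu> i" using l[OF that] \<mu> that by (simp add: feasible_def)
      then obtain \<delta> where \<delta>: "0 < \<delta>"
        "\<And>y. 0 \<le> y \<Longrightarrow> \<bar>y - (l i + \<mu> i)\<bar> < \<delta> \<Longrightarrow> g (l i + \<mu> i) - e' < g y"
        using g(1) e' unfolding lsc_nonneg_def by blast
      have "\<forall>\<^sub>F n in sequentially. dist (x (r n) i) (\<mu> i) < \<delta>"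
        using r(2)[OF that] \<delta>(1) by (rule tendstoD)
      then show ?thesis
      proof (rule eventually_mono)
        fix n assume "dist (x (r n) i) (\<mu> i) < \<delta>"
        then show "g (l i + \<mu> i) - e' < g (l i + x (r n) i)"
          using \<delta>(2)[of "l i + x (r n) i"] l[OF that] bound[OF that, of "r n"] by (simp add: dist_real_def)
      qed
    qed
    then have "\<forall>\<^sub>F n in sequentially. \<forall>i\<in>{..<d}. g (l i + \<mu> i) - e' < g (l i + x (r n) i)"
      by (intro eventually_ball_finite) auto
    moreover have "\<forall>\<^sub>F n in sequentially. 1 / real (Suc n) < e'"
      using e' LIMSEQ_inverse_real_of_nat by (auto simp: inverse_eq_divide dest: order_tendstoD)
    ultimately have "\<forall>\<^sub>F n in sequentially. (\<forall>i\<in>{..<d}. g (l i + \<mu> i) - e' < g (l i + x (r n) i)) \<and> 1 / real (Suc n) < e'"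
      by (rule eventually_conj)
    then obtain n where n: "\<And>i. i < d \<Longrightarrow> g (l i + \<mu> i) - e' < g (l i + x (r n) i)" "1 / real (Suc n) < e'"
      unfolding eventually_sequentially by auto
    have "shifted_sum d g l \<mu> - d * e' = (\<Sum>i<d. g (l i + \<mu> i) - e')"
      by (simp add: shifted_sum_def sum_subtractf)
    also have "\<dots> \<le> shifted_sum d g l (x (r n))"
      unfolding shifted_sum_def using n(1) by (intro sum_mono) (auto intro: less_imp_le)
    also have "\<dots> \<le> Inf V + 1 / real (Suc n)"
    proof -
      have "1 / real (Suc (r n)) \<le> 1 / real (Suc n)"
        using seq_suble[OF r(1), of n] by (intro divide_left_mono) auto
      then show ?thesis using x(2)[of "r n"] by simp
    qed
    finally have "shifted_sum d g l \<mu> < Inf V + (real d + 1) * e'"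
      using n(2) by (simp add: algebra_simps)
    then show "shifted_sum d g l \<mu> \<le> Inf V + e" by (simp add: e'_def)
  qed
  moreover have "Inf V \<le> shifted_sum d g l \<gamma>" if "feasible d k A \<gamma>" for \<gamma>
    using that bdd by (intro cInf_lower) (auto simp: V_def)
  ultimately show ?thesis using \<mu> by force
qed

text \<open>
  The midpoint of two different minimizers would do strictly better.
\<close>

lemma feasible_minimizer_unique:
  assumes g: "strictly_convex_nonneg g" and l: "\<And>i. i < d \<Longrightarrow> 0 \<le> l i"
    and \<mu>: "feasible d k A \<mu>" "\<And>\<gamma>. feasible d k A \<gamma> \<Longrightarrow> shifted_sum d g l \<mu> \<le> shifted_sum d g l \<gamma>"
    and \<gamma>: "feasible d k A \<gamma>" "shifted_sum d g l \<gamma> \<le> shifted_sum d g l \<mu>" and "i < d"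
  shows "\<gamma> i = \<mu> i"
proof (rule ccontr)
  assume neq: "\<gamma> i \<noteq> \<mu> i"
  define h where "h i = (g (l i + \<mu> i) + g (l i + \<gamma> i)) / 2" for i
  have mid: "g (l i + (\<mu> i + \<gamma> i) / 2) < h i" if "i < d" "\<gamma> i \<noteq> \<mu> i" for i
  proof -
    have "0 \<le> l i + \<mu> i" "0 \<le> l i + \<gamma> i" "l i + \<mu> i \<noteq> l i + \<gamma> i" "0 < (1 / 2 :: real)" "1 / 2 < (1 :: real)"
      using l[OF that(1)] \<mu>(1) \<gamma>(1) that by (auto simp: feasible_def)
    then have "g ((1 - 1 / 2) * (l i + \<mu> i) + 1 / 2 * (l i + \<gamma> i)) <
        (1 - 1 / 2) * g (l i + \<mu> i) + 1 / 2 * g (l i + \<gamma> i)"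
      using g unfolding strictly_convex_nonneg_def by blast
    moreover have "(1 - 1 / 2) * (l i + \<mu> i) + 1 / 2 * (l i + \<gamma> i) = l i + (\<mu> i + \<gamma> i) / 2"
      by (simp add: field_simps)
    ultimately show ?thesis by (simp add: h_def)
  qed
  have "shifted_sum d g l (\<lambda>i. (\<mu> i + \<gamma> i) / 2) < (\<Sum>i<d. h i)"
    unfolding shifted_sum_def
  proof (rule sum_strict_mono_ex1)
    show "\<forall>i\<in>{..<d}. g (l i + (\<mu> i + \<gamma> i) / 2) \<le> h i"
    proof
      fix i assume "i \<in> {..<d}"
      then show "g (l i + (\<mu> i + \<gamma> i) / 2) \<le> h i"
        using mid[of i] by (cases "\<gamma> i = \<mu> i") (auto simp: h_def)
    qed
    show "\<exists>i\<in>{..<d}. g (l i + (\<mu> i + \<gamma> i) / 2) < h i" using mid neq \<open>i < d\<close> by auto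
  qed simp
  also have "\<dots> = (shifted_sum d g l \<mu> + shifted_sum d g l \<gamma>) / 2"
    by (simp add: h_def shifted_sum_def sum.distrib flip: sum_divide_distrib)
  also have "\<dots> \<le> shifted_sum d g l \<mu>" using \<gamma>(2) by simp
  finally show False using \<mu>(2)[OF feasible_midpoint[OF \<mu>(1) \<gamma>(1)]] by simp
qed

lemma sum_update_two:
  fixes h :: "'b \<Rightarrow> 'c \<Rightarrow> real"
  assumes "finite S" "p \<noteq> q"
  shows "(\<Sum>i\<in>S. h i ((\<mu>(p := a, q := b)) i)) = (\<Sum>i\<in>S. h i (\<mu> i)) +
    (if p \<in> S then h p a - h p (\<mu> p) else 0) + (if q \<in> S then h q b - h q (\<mu> q) else 0)"
  using assms by (induction S rule: finite_induct) auto

text \<open>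
  Suppose that \<open>l i > l (i + 1)\<close> inside a block of equal positive entries of \<open>\<mu>\<close>, and let \<open>p\<close> and \<open>q\<close> be the ends of the
  block. Moving a small amount from \<open>\<mu> p\<close> to \<open>\<mu> q\<close> keeps \<open>\<mu>\<close> increasing and makes it more spread out, hence
  feasible, while \<open>l p + \<mu> p\<close> and \<open>l q + \<mu> q\<close> come closer, which lowers the sum.
\<close>

lemma minimizer_blocks:
  assumes g: "strictly_convex_nonneg g" and l: "\<And>i. i < d \<Longrightarrow> 0 \<le> l i"
    and dec: "\<And>i j. i \<le> j \<Longrightarrow> j < d \<Longrightarrow> l j \<le> l i"
    and \<mu>: "feasible d k A \<mu>" "\<And>\<gamma>. feasible d k A \<gamma> \<Longrightarrow> shifted_sum d g l \<mu> \<le> shifted_sum d g l \<gamma>"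
    and i: "i + 1 < d" "0 < \<mu> i" "\<mu> i = \<mu> (i + 1)"
  shows "l i = l (i + 1)"
proof (rule ccontr)
  assume "l i \<noteq> l (i + 1)"
  then have "l (i + 1) < l i" using dec[of i "i + 1"] i by simp
  define p where "p = (LEAST j. \<mu> j = \<mu> i)"
  define q where "q = (GREATEST j. j < d \<and> \<mu> j = \<mu> i)"
  have p: "\<mu> p = \<mu> i" "p \<le> i" unfolding p_def by (auto intro: LeastI Least_le)
  have q: "q < d" "\<mu> q = \<mu> i" "i + 1 \<le> q"
    using GreatestI_nat[of "\<lambda>j. j < d \<and> \<mu> j = \<mu> i" i d] Greatest_le_nat[of "\<lambda>j. j < d \<and> \<mu> j = \<mu> i" "i + 1" d] i
    unfolding q_def by auto
  have p_pred: "\<mu> (p - 1) < \<mu> p" if "0 < p"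
  proof -
    have "\<mu> (p - 1) \<noteq> \<mu> i" using not_less_Least[of "p - 1" "\<lambda>j. \<mu> j = \<mu> i"] that by (simp flip: p_def)
    then show ?thesis using feasible_mono[OF \<mu>(1), of "p - 1" p] p i by simp
  qed
  have q_succ: "\<mu> q < \<mu> (Suc q)" if "Suc q < d"
  proof -
    have "\<mu> (Suc q) \<noteq> \<mu> i"
      using Greatest_le_nat[of "\<lambda>j. j < d \<and> \<mu> j = \<mu> i" "Suc q" d] that unfolding q_def[symmetric] by auto
    then show ?thesis using feasible_mono[OF \<mu>(1), of q "Suc q"] q that by simp
  qed
  have l_pq: "l q < l p" using dec[of p i] dec[of "i + 1" q] p q i \<open>l (i + 1) < l i\<close> by linarith
  \<comment> \<open>The neighbours of the block bound the amount that can be moved, and it must stay below \<open>l p - l q\<close>.\<close>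
  define e where "e = min (min (if p = 0 then \<mu> p else \<mu> p - \<mu> (p - 1))
    (if Suc q < d then \<mu> (Suc q) - \<mu> q else 1)) ((l p - l q) / 2)"
  have e: "0 < e" "e < l p - l q" "p = 0 \<Longrightarrow> e \<le> \<mu> p" "0 < p \<Longrightarrow> e \<le> \<mu> p - \<mu> (p - 1)"
    "Suc q < d \<Longrightarrow> e \<le> \<mu> (Suc q) - \<mu> q"
    using p_pred q_succ l_pq p i(2) by (auto simp: e_def min_def)
  have e_le: "e \<le> \<mu> p"
  proof (cases "p = 0")
    case False
    have "0 \<le> \<mu> (p - 1)" using \<mu>(1) p i by (auto simp: feasible_def)
    then show ?thesis using e(4) False by simp
  qed (use e in simp)
  define \<gamma> where "\<gamma> = \<mu>(p := \<mu> p - e, q := \<mu> q + e)"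
  have pq: "p < q" using p q by simp
  have sum_\<gamma>: "(\<Sum>i\<in>S. \<gamma> i) = (\<Sum>i\<in>S. \<mu> i) + (if p \<in> S then - e else 0) + (if q \<in> S then e else 0)"
    if "finite S" for S
    using sum_update_two[OF that, of p q "\<lambda>_ x. x" \<mu> "\<mu> p - e" "\<mu> q + e"] pq by (simp add: \<gamma>_def)
  have "feasible d k A \<gamma>"
    unfolding feasible_def
  proof (intro conjI allI impI)
    show "0 \<le> \<gamma> i" if "i < d" for i using \<mu>(1) that e_le e(1) q(1) by (auto simp: \<gamma>_def feasible_def)
    show "\<gamma> i \<le> \<gamma> (Suc i)" if "Suc i < d" for i
    proof -
      have "\<mu> i \<le> \<mu> (Suc i)" using \<mu>(1) that by (simp add: feasible_def)
      moreover have "Suc i = p \<Longrightarrow> e \<le> \<mu> p - \<mu> i" using e(4) by auto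
      moreover have "i = q \<Longrightarrow> e \<le> \<mu> (Suc i) - \<mu> q" using e(5) that by auto
      ultimately show ?thesis using e(1) pq by (auto simp: \<gamma>_def)
    qed
    show "A j \<le> (\<Sum>i=d-j..<d. \<gamma> i)" for j
    proof -
      have "A j \<le> (\<Sum>i=d-j..<d. \<mu> i)" using \<mu>(1) by (simp add: feasible_def)
      then show ?thesis using pq q(1) e(1) by (auto simp: sum_\<gamma>)
    qed
    show "(\<Sum>i<d. \<gamma> i) = A k" using \<mu>(1) pq q(1) by (simp add: sum_\<gamma> feasible_def)
  qed
  moreover have "shifted_sum d g l \<gamma> < shifted_sum d g l \<mu>"
  proof -
    have "0 \<le> l q + \<mu> q" using l[of q] q i by simp
    then have "g (l p + (\<mu> p - e)) + g (l p + \<mu> p + (l q + \<mu> q) - (l p + (\<mu> p - e)))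
        < g (l p + \<mu> p) + g (l q + \<mu> q)"
      using e(1,2) p(1) q(2) by (intro strict_convex_transfer[OF g]) simp_all
    also have "l p + \<mu> p + (l q + \<mu> q) - (l p + (\<mu> p - e)) = l q + (\<mu> q + e)" by simp
    finally have "g (l p + (\<mu> p - e)) + g (l q + (\<mu> q + e)) < g (l p + \<mu> p) + g (l q + \<mu> q)" .
    then show ?thesis unfolding shifted_sum_def \<gamma>_def
      using sum_update_two[of "{..<d}" p q "\<lambda>i x. g (l i + x)" \<mu> "\<mu> p - e" "\<mu> q + e"] pq q(1)
      by (simp add: algebra_simps)
  qed
  ultimately show False using \<mu>(2) by fastforce
qed

text \<open>
  Suppose that some entry of \<open>l + \<mu>\<close> is 0, and let \<open>p\<close> be the last index with \<open>\<mu> p = 0\<close>. Then \<open>l\<close> vanishes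
  from \<open>p\<close> on, so \<open>\<mu>\<close> has fewer than \<open>k\<close> nonzero entries and the only majorization condition that separates \<open>p\<close> from
  \<open>p + 1\<close> is strict. This leaves room to move a little of \<open>\<mu> (p + 1)\<close> to \<open>\<mu> p\<close>, which lowers the sum. If \<open>p\<close> is the last index
  of all, \<open>\<mu>\<close> is zero, although it has the positive sum \<open>A k\<close>.
\<close>

lemma minimizer_positive:
  assumes g: "strictly_convex_nonneg g" and l: "\<And>i. i < d \<Longrightarrow> 0 \<le> l i"
    and dec: "\<And>i j. i \<le> j \<Longrightarrow> j < d \<Longrightarrow> l j \<le> l i"
    and A: "0 \<le> A 0" "\<And>j. j < k \<Longrightarrow> A j < A k"
    and zeros: "\<And>q. q < d \<Longrightarrow> l q = 0 \<Longrightarrow> d - q \<le> k"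
    and \<mu>: "feasible d k A \<mu>" "\<And>\<gamma>. feasible d k A \<gamma> \<Longrightarrow> shifted_sum d g l \<mu> \<le> shifted_sum d g l \<gamma>"
    and "i < d"
  shows "0 < l i + \<mu> i"
proof (rule ccontr)
  assume "\<not> 0 < l i + \<mu> i"
  moreover have "0 \<le> \<mu> i" using \<mu>(1) \<open>i < d\<close> by (simp add: feasible_def)
  ultimately have i: "l i = 0" "\<mu> i = 0" using l[OF \<open>i < d\<close>] by auto
  define p where "p = (GREATEST j. j < d \<and> \<mu> j = 0)"
  have p: "p < d" "\<mu> p = 0" "i \<le> p"
    using GreatestI_nat[of "\<lambda>j. j < d \<and> \<mu> j = 0" i d] Greatest_le_nat[of "\<lambda>j. j < d \<and> \<mu> j = 0" i d] i \<open>i < d\<close>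
    unfolding p_def by auto
  have l0: "l j = 0" if "p \<le> j" "j < d" for j
    using dec[of i j] l[of j] p i that by simp
  have dp: "d - p \<le> k" using zeros[OF p(1)] l0[of p] p(1) by simp
  have \<mu>0: "\<mu> j = 0" if "j \<le> p" for j
    using feasible_mono[OF \<mu>(1) that p(1)] \<mu>(1) p that by (auto simp: feasible_def intro: antisym)
  show False
  proof (cases "Suc p < d")
    case False
    then have "(\<Sum>i<d. \<mu> i) = 0" using \<mu>0 p(1) by (intro sum.neutral) auto
    then have "A k = 0" using \<mu>(1) by (simp add: feasible_def)
    moreover have "0 < k" using dp p(1) by linarith
    ultimately show False using A(1) A(2)[of 0] by simp
  next
    case True
    have "\<mu> (Suc p) \<noteq> 0"
      using Greatest_le_nat[of "\<lambda>j. j < d \<and> \<mu> j = 0" "Suc p" d] True unfolding p_def[symmetric] by auto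
    then have pos: "0 < \<mu> (Suc p)" using \<mu>(1) True by (auto simp: feasible_def less_le)
    have slack: "A (d - Suc p) < A k" using dp p(1) by (intro A(2)) simp
    define e where "e = min (A k - A (d - Suc p)) (\<mu> (Suc p) / 2)"
    have e: "0 < e" "e \<le> A k - A (d - Suc p)" "e \<le> \<mu> (Suc p) - e" "e < \<mu> (Suc p)"
      using pos slack by (auto simp: e_def min_def)
    define \<gamma> where "\<gamma> = \<mu>(p := e, Suc p := \<mu> (Suc p) - e)"
    have sum_\<gamma>: "(\<Sum>i\<in>S. \<gamma> i) = (\<Sum>i\<in>S. \<mu> i) + (if p \<in> S then e else 0) + (if Suc p \<in> S then - e else 0)"
      if "finite S" for S
      using sum_update_two[OF that, of p "Suc p" "\<lambda>_ x. x" \<mu> e "\<mu> (Suc p) - e"] p by (simp add: \<gamma>_def)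
    have "feasible d k A \<gamma>"
      unfolding feasible_def
    proof (intro conjI allI impI)
      show "0 \<le> \<gamma> i" if "i < d" for i using \<mu>(1) that e by (auto simp: \<gamma>_def feasible_def)
      show "\<gamma> i \<le> \<gamma> (Suc i)" if "Suc i < d" for i
      proof -
        have "\<mu> i \<le> \<mu> (Suc i)" using \<mu>(1) that by (simp add: feasible_def)
        moreover have "Suc i = p \<Longrightarrow> \<mu> i = 0" using \<mu>0 by simp
        ultimately show ?thesis using e by (auto simp: \<gamma>_def)
      qed
      show "A j \<le> (\<Sum>i=d-j..<d. \<gamma> i)" for j
      proof (cases "d - j = Suc p")
        case True
        then have j: "j = d - Suc p" by simp
        have "{..p} \<union> {Suc p..<d} = {..<d}" using p(1) by auto
        then have "(\<Sum>i<d. \<mu> i) = (\<Sum>i\<le>p. \<mu> i) + (\<Sum>i=Suc p..<d. \<mu> i)"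
          using sum.union_disjoint[of "{..p}" "{Suc p..<d}" \<mu>] by force
        then have "(\<Sum>i=Suc p..<d. \<mu> i) = A k" using \<mu>0 \<mu>(1) by (simp add: feasible_def)
        then show ?thesis using True e(2) \<open>Suc p < d\<close> by (simp add: sum_\<gamma> j)
      next
        case False
        have "A j \<le> (\<Sum>i=d-j..<d. \<mu> i)" using \<mu>(1) by (simp add: feasible_def)
        then show ?thesis using False \<open>Suc p < d\<close> by (auto simp: sum_\<gamma>)
      qed
      show "(\<Sum>i<d. \<gamma> i) = A k" using \<mu>(1) True by (simp add: sum_\<gamma> feasible_def)
    qed
    moreover have "shifted_sum d g l \<gamma> < shifted_sum d g l \<mu>"
    proof -
      have "l p = 0" "l (Suc p) = 0" using l0 True by auto
      moreover have "g (\<mu> (Suc p) - e) + g e < g (\<mu> (Suc p)) + g 0"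
        using strict_convex_transfer[OF g, of 0 "\<mu> (Suc p) - e" "\<mu> (Suc p)"] e by simp
      ultimately show ?thesis unfolding shifted_sum_def \<gamma>_def
        using sum_update_two[of "{..<d}" p "Suc p" "\<lambda>i x. g (l i + x)" \<mu> e "\<mu> (Suc p) - e"] True p(2)
        by simp
    qed
    ultimately show False using \<mu>(2) by fastforce
  qed
qed

text \<open>
  The minimizer for the regularized function has only positive entries in \<open>l + \<mu>\<close>, where \<open>f\<close> and its
  regularization \<open>g\<close> agree. Since \<open>g\<close> is nowhere above \<open>f\<close>, the same vector is optimal for \<open>f\<close>.
\<close>

theorem feasible_optimum:
  assumes f: "strictly_convex_nonneg f" "\<And>x. 0 \<le> x \<Longrightarrow> 0 \<le> f x" and l: "\<And>i. i < d \<Longrightarrow> 0 \<le> l i"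
    and dec: "\<And>i j. i \<le> j \<Longrightarrow> j < d \<Longrightarrow> l j \<le> l i"
    and A: "0 \<le> A 0" "\<And>j. j < k \<Longrightarrow> A j < A k"
    and zeros: "\<And>q. q < d \<Longrightarrow> l q = 0 \<Longrightarrow> d - q \<le> k"
    and ne: "feasible d k A \<gamma>0"
  obtains \<mu> where "feasible d k A \<mu>"
    "\<And>\<gamma>. feasible d k A \<gamma> \<Longrightarrow> shifted_sum d f l \<mu> \<le> shifted_sum d f l \<gamma>"
proof -
  obtain g where g: "strictly_convex_nonneg g" "lsc_nonneg g" "\<And>x. 0 < x \<Longrightarrow> g x = f x" "g 0 \<le> f 0"
    using lsc_regularization[OF f(1)] by blast
  have bound: "min 0 (g 0) \<le> g y" if "0 \<le> y" for y
    using g(3)[of y] f(2)[of y] that by (cases "y = 0") auto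
  obtain \<mu> where \<mu>: "feasible d k A \<mu>" "\<And>\<gamma>. feasible d k A \<gamma> \<Longrightarrow> shifted_sum d g l \<mu> \<le> shifted_sum d g l \<gamma>"
    using exists_feasible_minimizer[where l = l, OF ne g(2) bound l] by blast
  have pos: "0 < l i + \<mu> i" if "i < d" for i
    by (rule minimizer_positive[OF g(1) l dec A zeros \<mu> that])
  have "shifted_sum d f l \<mu> \<le> shifted_sum d f l \<gamma>" if "feasible d k A \<gamma>" for \<gamma>
  proof -
    have "shifted_sum d f l \<mu> = shifted_sum d g l \<mu>"
      using pos g(3) by (simp add: shifted_sum_def)
    also have "\<dots> \<le> shifted_sum d g l \<gamma>" by (rule \<mu>(2)[OF that])
    also have "\<dots> \<le> shifted_sum d f l \<gamma>"
      unfolding shifted_sum_def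
    proof (intro sum_mono)
      fix i assume "i \<in> {..<d}"
      then have "0 \<le> l i + \<gamma> i" using l that by (simp add: feasible_def)
      then show "g (l i + \<gamma> i) \<le> f (l i + \<gamma> i)"
        using g(3)[of "l i + \<gamma> i"] g(4) by (cases "l i + \<gamma> i = 0") auto
    qed
    finally show ?thesis .
  qed
  with \<mu>(1) show ?thesis using that by blast
qed

section \<open>Spectra of frames with prescribed norms\<close>

text \<open>
  For a nonnegative vector of dimension at most \<open>m\<close> this is the decreasing rearrangement of its padding by zeros.
\<close>

definition padded_dec :: "nat \<Rightarrow> real vec \<Rightarrow> real list" where
  "padded_dec m x = rev (sort (list_of_vec x)) @ replicate (m - dim_vec x) 0"

definition top_sum :: "real vec \<Rightarrow> nat \<Rightarrow> real" where
  "top_sum x j = sum_list (take j (rev (sort (list_of_vec x))))"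

lemma mem_list_of_vec: "y \<in> set (list_of_vec x) \<longleftrightarrow> (\<exists>i<dim_vec x. y = x $ i)"
  by (auto simp: in_set_conv_nth list_of_vec_index)

lemma sorted_padded_dec:
  assumes "\<And>i. i < dim_vec x \<Longrightarrow> 0 \<le> x $ i"
  shows "sorted_wrt (\<ge>) (padded_dec m x)"
proof -
  have "sorted_wrt (\<ge>) (replicate n (0 :: real))" for n by (induction n) auto
  then show ?thesis
    using assms sorted_rev_sort[of "list_of_vec x"]
    by (auto simp: padded_dec_def sorted_wrt_append mem_list_of_vec)
qed

lemma dec_rearr_zero_pad:
  assumes "\<And>i. i < dim_vec x \<Longrightarrow> 0 \<le> x $ i" "dim_vec x \<le> m"
  shows "dec_rearr (zero_pad m x) = vec_of_list (padded_dec m x)"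
proof -
  have "list_of_vec (zero_pad m x) = list_of_vec x @ replicate (m - dim_vec x) 0"
    using assms(2) by (intro nth_equalityI) (auto simp: zero_pad_def list_of_vec_index nth_append)
  moreover have "sorted_wrt (\<ge>) (padded_dec m x)" by (rule sorted_padded_dec[OF assms(1)])
  ultimately have "rev (sort (list_of_vec (zero_pad m x))) = padded_dec m x"
    by (intro rev_sort_eq) (auto simp: padded_dec_def)
  then show ?thesis by (simp add: dec_rearr_def)
qed

lemma length_padded_dec: "dim_vec x \<le> m \<Longrightarrow> length (padded_dec m x) = m"
  by (simp add: padded_dec_def)

lemma sum_list_take_padded_dec: "sum_list (take j (padded_dec m x)) = top_sum x j"
  by (simp add: padded_dec_def top_sum_def sum_list_replicate)

lemma sum_list_padded_dec: "sum_list (padded_dec m x) = top_sum x (dim_vec x)"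
  by (simp add: padded_dec_def top_sum_def sum_list_replicate)

lemma majorized_by_iff_list_majorized:
  assumes "\<And>i. i < dim_vec x \<Longrightarrow> 0 \<le> x $ i" "\<And>i. i < dim_vec y \<Longrightarrow> 0 \<le> y $ i"
  defines "m \<equiv> max (dim_vec x) (dim_vec y)"
  shows "majorized_by x y \<longleftrightarrow> list_majorized (padded_dec m x) (padded_dec m y)"
proof -
  have m: "dim_vec x \<le> m" "dim_vec y \<le> m" by (auto simp: m_def)
  have len: "length (padded_dec m x) = m" "length (padded_dec m y) = m"
    using m by (simp_all add: length_padded_dec)
  have all: "(\<forall>j\<le>m. sum_list (take j (padded_dec m x)) \<le> sum_list (take j (padded_dec m y))) \<longleftrightarrow>
     (\<forall>j. sum_list (take j (padded_dec m x)) \<le> sum_list (take j (padded_dec m y)))" (is "?L \<longleftrightarrow> ?R")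
  proof
    assume L: ?L
    show ?R
    proof
      fix j
      show "sum_list (take j (padded_dec m x)) \<le> sum_list (take j (padded_dec m y))"
        using L[rule_format, of "min j m"] len by (cases "j \<le> m") (auto simp: min_def)
    qed
  qed blast
  have prefix: "(\<Sum>i<j. dec_rearr (zero_pad m x) $ i) = sum_list (take j (padded_dec m x))"
    "(\<Sum>i<j. dec_rearr (zero_pad m y) $ i) = sum_list (take j (padded_dec m y))" if "j \<le> m" for j
    using that len dec_rearr_zero_pad[of x m] dec_rearr_zero_pad[of y m] assms(1,2) m
    by (simp_all add: sum_eq_sum_list_take)
  have "majorized_by x y \<longleftrightarrow>
    (\<forall>j\<le>m. sum_list (take j (padded_dec m x)) \<le> sum_list (take j (padded_dec m y))) \<and>
    sum_list (take m (padded_dec m x)) = sum_list (take m (padded_dec m y))"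
    unfolding majorized_by_def Let_def m_def[symmetric] by (simp add: prefix)
  then show ?thesis unfolding all list_majorized_def using len by auto
qed

lemma top_sum_increasing:
  assumes "\<And>i. Suc i < dim_vec \<mu> \<Longrightarrow> \<mu> $ i \<le> \<mu> $ Suc i"
  shows "top_sum \<mu> j = (\<Sum>i=dim_vec \<mu> - j..<dim_vec \<mu>. \<mu> $ i)"
proof -
  have "sorted (list_of_vec \<mu>)"
    using assms by (simp add: sorted_iff_nth_Suc list_of_vec_index)
  then have "top_sum \<mu> j = sum_list (drop (dim_vec \<mu> - j) (list_of_vec \<mu>))"
    by (simp add: top_sum_def sorted_sort_id take_rev)
  also have "drop (dim_vec \<mu> - j) (list_of_vec \<mu>) = map (\<lambda>i. \<mu> $ i) [dim_vec \<mu> - j..<dim_vec \<mu>]"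
    by (simp add: list_of_vec_map drop_map)
  finally show ?thesis by (simp add: sum_list_distinct_conv_sum_set)
qed

lemma inc_rearr_fixed_iff:
  "\<mu> = inc_rearr \<mu> \<longleftrightarrow> (\<forall>i. Suc i < dim_vec \<mu> \<longrightarrow> \<mu> $ i \<le> \<mu> $ Suc i)"
proof -
  have "\<mu> = inc_rearr \<mu> \<longleftrightarrow> list_of_vec \<mu> = sort (list_of_vec \<mu>)"
    unfolding inc_rearr_def by (metis list_vec vec_list)
  also have "\<dots> \<longleftrightarrow> sorted (list_of_vec \<mu>)" by (metis sorted_sort sorted_sort_id)
  finally show ?thesis by (simp add: sorted_iff_nth_Suc list_of_vec_index)
qed

lemma Gamma_set_iff_feasible:
  assumes a: "\<And>i. i < dim_vec a \<Longrightarrow> 0 < a $ i"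
  shows "\<mu> \<in> Gamma_set d a \<longleftrightarrow>
    \<mu> \<in> carrier_vec d \<and> feasible d (dim_vec a) (top_sum a) (\<lambda>i. \<mu> $ i)"
proof (cases "\<mu> \<in> carrier_vec d \<and> (\<forall>i<d. 0 \<le> \<mu> $ i) \<and> (\<forall>i. Suc i < d \<longrightarrow> \<mu> $ i \<le> \<mu> $ Suc i)")
  case True
  then have dim: "dim_vec \<mu> = d" by simp
  define m where "m = max (dim_vec a) (dim_vec \<mu>)"
  have m: "dim_vec a \<le> m" "dim_vec \<mu> \<le> m" by (auto simp: m_def)
  have tails: "top_sum \<mu> j = (\<Sum>i=d-j..<d. \<mu> $ i)" for j
    using top_sum_increasing[of \<mu> j] True by (simp add: dim)
  have "majorized_by a \<mu> \<longleftrightarrow> list_majorized (padded_dec m a) (padded_dec m \<mu>)"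
    unfolding m_def using a True by (intro majorized_by_iff_list_majorized) (auto intro: less_imp_le)
  also have "\<dots> \<longleftrightarrow> top_sum \<mu> d = top_sum a (dim_vec a) \<and> (\<forall>j. top_sum a j \<le> top_sum \<mu> j)"
    using m by (auto simp: list_majorized_def length_padded_dec sum_list_take_padded_dec sum_list_padded_dec dim)
  finally have "majorized_by a \<mu> \<longleftrightarrow> (\<Sum>i<d. \<mu> $ i) = top_sum a (dim_vec a) \<and>
      (\<forall>j. top_sum a j \<le> (\<Sum>i=d-j..<d. \<mu> $ i))"
    unfolding tails by (simp add: lessThan_atLeast0)
  then show ?thesis
    using True inc_rearr_fixed_iff[of \<mu>] unfolding Gamma_set_def feasible_def by auto
next
  case False
  then show ?thesis
    using inc_rearr_fixed_iff[of \<mu>] unfolding Gamma_set_def feasible_def by auto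
qed

lemma top_sum_0 [simp]: "top_sum x 0 = 0"
  by (simp add: top_sum_def)

lemma top_sum_less_total:
  assumes a: "\<And>i. i < dim_vec a \<Longrightarrow> 0 < a $ i" and "j < dim_vec a"
  shows "top_sum a j < top_sum a (dim_vec a)"
proof -
  define xs where "xs = rev (sort (list_of_vec a))"
  have pos: "0 < x" if "x \<in> set xs" for x
    using that a by (auto simp: xs_def mem_list_of_vec)
  have "drop j xs \<noteq> []" using assms(2) by (simp add: xs_def)
  then obtain y ys where y: "drop j xs = y # ys" by (cases "drop j xs") auto
  then have "0 < y" "\<forall>z\<in>set ys. 0 < z" using pos in_set_dropD[of _ j xs] by auto
  then have "0 < sum_list (drop j xs)" unfolding y by (simp add: add_pos_nonneg sum_list_nonneg less_imp_le)
  moreover have "sum_list xs = sum_list (take j xs) + sum_list (drop j xs)"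
    by (metis append_take_drop_id sum_list_append)
  ultimately show ?thesis by (simp add: top_sum_def xs_def)
qed

lemma top_sum_le_total:
  assumes a: "\<And>i. i < dim_vec a \<Longrightarrow> 0 < a $ i"
  shows "top_sum a j \<le> top_sum a (dim_vec a)"
  using top_sum_less_total[OF a, of j] by (cases "j < dim_vec a") (auto simp: top_sum_def)

lemma exists_feasible:
  assumes a: "\<And>i. i < dim_vec a \<Longrightarrow> 0 < a $ i" and "0 < d"
  shows "feasible d (dim_vec a) (top_sum a) (\<lambda>i. if i = d - 1 then top_sum a (dim_vec a) else 0)"
proof -
  have "0 \<le> top_sum a (dim_vec a)" using top_sum_le_total[OF a, of 0] by simp
  moreover have "top_sum a j \<le> (\<Sum>i=d-j..<d. if i = d - 1 then top_sum a (dim_vec a) else 0)" for j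
    using top_sum_le_total[OF a, of j] \<open>0 < d\<close> by (cases "j = 0") auto
  ultimately show ?thesis using \<open>0 < d\<close> by (auto simp: feasible_def)
qed

lemma exists_permutation_with_map:
  assumes "mset (map f ys) = mset xs"
  obtains ys' where "mset ys' = mset ys" "map f ys' = xs"
proof -
  have "mset xs = mset (map f ys)" using assms by simp
  then obtain p where p: "p permutes {..<length (map f ys)}" "permute_list p (map f ys) = xs"
    by (rule mset_eq_permutation)
  then have "mset (permute_list p ys) = mset ys" "map f (permute_list p ys) = xs"
    by (simp_all add: permute_list_map)
  then show ?thesis using that by blast
qed

lemma eigs_inc_index:
  assumes "hermitian d A"
  shows "eigs_inc A = vec d (\<lambda>i. eigs_dec A $ (d - 1 - i))"
proof -
  note eigs = hermitian_eigs_dec(2,3)[OF assms]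
  have "sorted_wrt (\<ge>) (list_of_vec (eigs_dec A))"
    using eigs by (subst decreasing_iff_sorted) simp
  then have "sort (list_of_vec (eigs_dec A)) = rev (list_of_vec (eigs_dec A))"
    using rev_sort_eq[of "list_of_vec (eigs_dec A)" "list_of_vec (eigs_dec A)"] by (simp add: rev_swap)
  then show ?thesis
    using eigs unfolding eigs_inc_def inc_rearr_def
    by (intro eq_vecI) (auto simp: vec_of_list_index rev_nth list_of_vec_index)
qed

text \<open>
  Reordering the frame so that its norms decrease turns the sums of squared norms in
  \<open>norms_majorized_by_spectrum\<close> into sums of the largest entries of \<open>a\<close>.
\<close>

theorem spectrum_in_Gamma_set:
  assumes G: "set G \<subseteq> carrier_vec d" and norms: "map sq_norm G = list_of_vec a"
    and a: "\<And>i. i < dim_vec a \<Longrightarrow> 0 < a $ i"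
  shows "eigs_inc (frame_op d G) \<in> Gamma_set d a"
proof -
  have herm: "hermitian d (frame_op d G)" by (rule hermitian_frame_op[OF G])
  define c where "c i = eigs_dec (frame_op d G) $ i" for i
  obtain w where w: "eigenbasis d (frame_op d G) w c"
    using hermitian_eigs_dec(1)[OF herm] by (auto simp: c_def[abs_def])
  have dec: "c j \<le> c i" if "i \<le> j" "j < d" for i j
    using hermitian_eigs_dec(3)[OF herm that] by (simp add: c_def)
  have inc: "eigs_inc (frame_op d G) = vec d (\<lambda>i. c (d - 1 - i))"
    by (simp add: eigs_inc_index[OF herm] c_def)
  have "mset (map sq_norm G) = mset (rev (sort (list_of_vec a)))" by (simp add: norms)
  then obtain H where H: "mset H = mset G" "map sq_norm H = rev (sort (list_of_vec a))"
    by (rule exists_permutation_with_map)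
  have Hset: "set H \<subseteq> carrier_vec d" using G mset_eq_setD[OF H(1)] by simp
  have S: "frame_op d H = frame_op d G" by (rule frame_op_mset_cong[OF H(1) G])
  have tail: "(\<Sum>i=d-j..<d. c (d - 1 - i)) = (\<Sum>i<min j d. c i)" for j
    by (rule sum.reindex_bij_witness[of _ "\<lambda>i. d - 1 - i" "\<lambda>i. d - 1 - i"]) auto
  have "top_sum a j \<le> (\<Sum>i=d-j..<d. c (d - 1 - i))" for j
  proof -
    have "top_sum a j = (\<Sum>g\<leftarrow>take j H. sq_norm g)"
      by (simp add: top_sum_def take_map flip: H(2))
    also have "\<dots> \<le> (\<Sum>i<min j d. c i)"
      using norms_majorized_by_spectrum[OF Hset, of w c j] w dec S by simp
    finally show ?thesis unfolding tail .
  qed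
  moreover have "(\<Sum>i<d. c (d - 1 - i)) = top_sum a (dim_vec a)"
  proof -
    have "top_sum a (dim_vec a) = sum_list (rev (sort (list_of_vec a)))" by (simp add: top_sum_def)
    also have "\<dots> = (\<Sum>g\<leftarrow>H. sq_norm g)" by (simp only: H(2))
    also have "\<dots> = (\<Sum>i<d. c i)"
      using trace_frame_op[OF Hset] trace_eigenbasis[OF w] unfolding S by (simp only: of_real_eq_iff)
    also have "\<dots> = (\<Sum>i<d. c (d - 1 - i))" using tail[of d] by (simp add: lessThan_atLeast0)
    finally show ?thesis by simp
  qed
  moreover have "0 \<le> c i" if "i < d" for i by (rule eigenbasis_frame_op_nonneg[OF w G that])
  ultimately have "feasible d (dim_vec a) (top_sum a) (\<lambda>i. c (d - 1 - i))"
    using dec by (auto simp: feasible_def)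
  then have "feasible d (dim_vec a) (top_sum a) (\<lambda>i. eigs_inc (frame_op d G) $ i)"
    unfolding inc feasible_def by auto
  then show ?thesis using Gamma_set_iff_feasible[OF a] by (simp add: inc)
qed

text \<open>
  The scaled vectors of the basis \<open>u\<close> have the frame operator with spectrum \<open>\<mu>\<close> and squared norms \<open>\<mu>\<close>. Averaging
  brings the norms to \<open>a\<close>. Zero vectors equalize the lengths of \<open>a\<close> and \<open>\<mu>\<close> before this step; if \<open>a\<close> is
  the shorter one, some of the resulting vectors have norm zero and can be dropped.
\<close>

theorem exists_frame_with_spectrum:
  assumes a: "\<And>i. i < dim_vec a \<Longrightarrow> 0 < a $ i" and \<mu>: "\<mu> \<in> Gamma_set d a"
    and u: "eigenbasis d A u l"
  obtains G where "set G \<subseteq> carrier_vec d" "map sq_norm G = list_of_vec a"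
    "eigenbasis d (frame_op d G) u (\<lambda>i. \<mu> $ i)"
proof -
  define k m where "k = dim_vec a" and "m = max (dim_vec a) (dim_vec \<mu>)"
  have \<mu>d: "dim_vec \<mu> = d" "\<And>i. i < d \<Longrightarrow> 0 \<le> \<mu> $ i" "majorized_by a \<mu>"
    using \<mu> by (auto simp: Gamma_set_def)
  have m: "k \<le> m" "d \<le> m" by (auto simp: m_def k_def \<mu>d)
  have "list_majorized (padded_dec m a) (padded_dec m \<mu>)"
    using majorized_by_iff_list_majorized[of a \<mu>] a \<mu>d by (simp add: m_def less_imp_le)
  then have avg: "averaging (mset (padded_dec m \<mu>)) (mset (padded_dec m a))"
    using a \<mu>d by (intro averaging_if_list_majorized sorted_padded_dec) (auto intro: less_imp_le)
  define D where "D = diagonal_frame u (\<lambda>i. \<mu> $ i) d"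
  have "eigenbasis d (frame_op d D) u (\<lambda>i. if i < d then \<mu> $ i else 0)"
    unfolding D_def using \<mu>d(2) by (intro eigenbasis_diagonal_frame[OF u]) auto
  then have D: "set D \<subseteq> carrier_vec d" "eigenbasis d (frame_op d D) u (\<lambda>i. \<mu> $ i)"
    unfolding D_def using diagonal_frame_carrier[OF u] by (auto elim: eigenbasis_cong)
  have norm_D: "map sq_norm D = list_of_vec \<mu>"
  proof (intro nth_equalityI)
    fix i assume "i < length (map sq_norm D)"
    then have i: "i < d" by (simp add: D_def diagonal_frame_def)
    have "sq_norm (u i) = 1" using eigenbasisD(2,3)[OF u, of i] i by (simp add: sq_norm_def)
    then show "map sq_norm D ! i = list_of_vec \<mu> ! i"
      using i \<mu>d eigenbasisD(2)[OF u i]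
      by (simp add: D_def diagonal_frame_def list_of_vec_index sq_norm_smult[of _ d])
  qed (simp add: D_def diagonal_frame_def \<mu>d)
  have zeros: "frame_op d (X @ replicate n (0\<^sub>v d)) = frame_op d X" if "set X \<subseteq> carrier_vec d" for X n
  proof -
    have XX: "set (X @ replicate n (0\<^sub>v d)) \<subseteq> carrier_vec d" using that by auto
    show ?thesis
      using that frame_op_carrier[OF that] frame_op_carrier[OF XX] frame_op_entry[OF XX]
      by (intro eq_matI) (auto simp: frame_op_entry sum_list_replicate)
  qed
  define E where "E = D @ replicate (m - d) (0\<^sub>v d)"
  have "mset (map sq_norm E) = mset (padded_dec m \<mu>)"
    using norm_D by (simp add: E_def padded_dec_def \<mu>d sq_norm_def)
  moreover have "set E \<subseteq> carrier_vec d" using D(1) by (auto simp: E_def)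
  ultimately obtain H where H: "set H \<subseteq> carrier_vec d" "mset (map sq_norm H) = mset (padded_dec m a)"
    "frame_op d H = frame_op d E"
    using frame_norms_averaging[OF avg, of d "frame_op d E"] by blast
  have "mset (map sq_norm H) = mset (list_of_vec a @ replicate (m - k) 0)"
    using H(2) by (simp add: padded_dec_def k_def)
  then obtain K where K: "mset K = mset H" "map sq_norm K = list_of_vec a @ replicate (m - k) 0"
    by (rule exists_permutation_with_map)
  have Kset: "set K \<subseteq> carrier_vec d" using H(1) mset_eq_setD[OF K(1)] by simp
  define G where "G = take k K"
  have "map sq_norm G = list_of_vec a" "map sq_norm (drop k K) = replicate (m - k) 0"
    unfolding G_def by (simp_all add: K(2) k_def flip: take_map drop_map)
  note G_norms = this
  have "drop k K = replicate (m - k) (0\<^sub>v d)"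
  proof (rule replicate_eqI)
    show "length (drop k K) = m - k" using arg_cong[OF G_norms(2), of length] by simp
    fix x assume x: "x \<in> set (drop k K)"
    then have "sq_norm x \<in> set (map sq_norm (drop k K))" by simp
    then have "sq_norm x = 0" by (simp add: G_norms(2) split: if_splits)
    then show "x = 0\<^sub>v d" using x Kset in_set_dropD[of x k K] by (intro sq_norm_eq_0) auto
  qed
  then have K_eq: "K = G @ replicate (m - k) (0\<^sub>v d)" by (metis G_def append_take_drop_id)
  have Gset: "set G \<subseteq> carrier_vec d" using Kset by (auto simp: K_eq)
  have "frame_op d G = frame_op d K" using zeros[OF Gset, of "m - k"] K_eq by metis
  also have "\<dots> = frame_op d H" by (rule frame_op_mset_cong[OF K(1) H(1)])
  also have "\<dots> = frame_op d D" using zeros[OF D(1)] by (simp add: H(3) E_def)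
  finally show ?thesis using that Gset G_norms(1) D(2) by simp
qed

text \<open>
  The \<open>j\<close> largest entries of \<open>x\<close> sit at the indices in some set with \<open>j\<close> elements.
\<close>

lemma list_majorized_if_subset_sums:
  assumes x: "dim_vec x = d" and c: "dim_vec c = d"
    and le: "\<And>J. J \<subseteq> {..<d} \<Longrightarrow> (\<Sum>i\<in>J. x $ i) \<le> (\<Sum>i<card J. c $ i)"
    and total: "(\<Sum>i<d. x $ i) = (\<Sum>i<d. c $ i)"
  shows "list_majorized (rev (sort (list_of_vec x))) (list_of_vec c)"
proof -
  obtain p where p: "p permutes {..<d}" "\<And>i. i < d \<Longrightarrow> dec_rearr x $ i = x $ p i"
    using dec_rearr_permutation[of x] x by metis
  have prefix: "sum_list (take j (rev (sort (list_of_vec x)))) = (\<Sum>i\<in>p ` {..<j}. x $ i)" if "j \<le> d" for j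
  proof -
    have "sum_list (take j (rev (sort (list_of_vec x)))) = (\<Sum>i<j. dec_rearr x $ i)"
      using that x by (simp add: dec_rearr_def sum_eq_sum_list_take)
    also have "\<dots> = (\<Sum>i<j. x $ p i)" using p(2) that by (intro sum.cong) auto
    also have "\<dots> = (\<Sum>i\<in>p ` {..<j}. x $ i)"
      using permutes_inj_on[OF p(1)] by (simp add: sum.reindex)
    finally show ?thesis .
  qed
  have prefix_c: "sum_list (take j (list_of_vec c)) = (\<Sum>i<j. c $ i)" if "j \<le> d" for j
    using sum_eq_sum_list_take[of j "list_of_vec c"] that c by (simp add: vec_list)
  have "p ` {..<d} = {..<d}" by (rule permutes_image[OF p(1)])
  then have tot: "sum_list (rev (sort (list_of_vec x))) = sum_list (list_of_vec c)"
    using prefix[of d] prefix_c[of d] total x c by simp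
  have "sum_list (take j (rev (sort (list_of_vec x)))) \<le> sum_list (take j (list_of_vec c))" for j
  proof (cases "j \<le> d")
    case True
    have "p ` {..<j} \<subseteq> p ` {..<d}" using True by (intro image_mono) auto
    then have "p ` {..<j} \<subseteq> {..<d}" by (simp add: \<open>p ` {..<d} = {..<d}\<close>)
    moreover have "card (p ` {..<j}) = j" using permutes_inj_on[OF p(1)] by (simp add: card_image)
    ultimately show ?thesis using le[of "p ` {..<j}"] True by (simp add: prefix prefix_c)
  next
    case False
    then show ?thesis using tot x c by simp
  qed
  then show ?thesis using tot x c by (simp add: list_majorized_def)
qed

theorem spectrum_of_sum_averages_to_opposite_sum:
  assumes A: "hermitian d A" and B: "hermitian d B"
  shows "averaging (mset (list_of_vec (eigs_dec (A + B)))) (mset (list_of_vec (eigs_dec A + eigs_inc B)))"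
proof -
  have carr: "A \<in> carrier_mat d d" "B \<in> carrier_mat d d" using A B by (auto simp: hermitian_def)
  have AB: "hermitian d (A + B)"
  proof -
    have "(A + B) $$ (i, j) = cnj ((A + B) $$ (j, i))" if "i < d" "j < d" for i j
    proof -
      have "A $$ (i, j) = cnj (A $$ (j, i))" "B $$ (i, j) = cnj (B $$ (j, i))"
        using A B that unfolding hermitian_def by blast+
      then show ?thesis using carr that by simp
    qed
    then show ?thesis using carr unfolding hermitian_def by auto
  qed
  obtain u v w where e: "eigenbasis d A u (\<lambda>i. eigs_dec A $ i)" "eigenbasis d B v (\<lambda>i. eigs_dec B $ i)"
    "eigenbasis d (A + B) w (\<lambda>i. eigs_dec (A + B) $ i)"
    using hermitian_eigs_dec(1)[OF A] hermitian_eigs_dec(1)[OF B] hermitian_eigs_dec(1)[OF AB] by blast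
  note dims = hermitian_eigs_dec(2)[OF A] hermitian_eigs_dec(2)[OF B] hermitian_eigs_dec(2)[OF AB]
  define x where "x = eigs_dec A + eigs_inc B"
  have x: "dim_vec x = d" "\<And>i. i < d \<Longrightarrow> x $ i = eigs_dec A $ i + eigs_dec B $ (d - 1 - i)"
    by (simp_all add: x_def eigs_inc_index[OF B] dims)
  have "list_majorized (rev (sort (list_of_vec x))) (list_of_vec (eigs_dec (A + B)))"
  proof (rule list_majorized_if_subset_sums[OF x(1) dims(3)])
    fix J assume J: "J \<subseteq> {..<d}"
    have "(\<Sum>i\<in>J. x $ i) = (\<Sum>i\<in>J. eigs_dec A $ i + eigs_dec B $ (d - 1 - i))"
      using J x(2) by (intro sum.cong) auto
    also have "\<dots> \<le> (\<Sum>i<card J. eigs_dec (A + B) $ i)"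
      by (rule lidskii[OF e(1) hermitian_eigs_dec(3)[OF A] e(2) hermitian_eigs_dec(3)[OF B]
          e(3) hermitian_eigs_dec(3)[OF AB] J])
    finally show "(\<Sum>i\<in>J. x $ i) \<le> (\<Sum>i<card J. eigs_dec (A + B) $ i)" .
  next
    have "(\<Sum>i<d. x $ i) = (\<Sum>i<d. eigs_dec A $ i) + (\<Sum>i<d. eigs_dec B $ (d - 1 - i))"
      using x(2) by (simp add: sum.distrib)
    also have "(\<Sum>i<d. eigs_dec B $ (d - 1 - i)) = (\<Sum>i<d. eigs_dec B $ i)"
      by (rule sum.reindex_bij_witness[of _ "\<lambda>i. d - 1 - i" "\<lambda>i. d - 1 - i"]) auto
    also have "(\<Sum>i<d. eigs_dec A $ i) + \<dots> = (\<Sum>i<d. eigs_dec (A + B) $ i)"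
      using trace_add[OF carr] unfolding trace_eigenbasis[OF e(1)] trace_eigenbasis[OF e(2)] trace_eigenbasis[OF e(3)]
      by (simp only: of_real_add[symmetric] of_real_eq_iff)
    finally show "(\<Sum>i<d. x $ i) = (\<Sum>i<d. eigs_dec (A + B) $ i)" .
  qed
  moreover have "sorted_wrt (\<ge>) (list_of_vec (eigs_dec (A + B)))"
    using hermitian_eigs_dec(3)[OF AB] dims by (subst decreasing_iff_sorted) simp
  ultimately have "averaging (mset (list_of_vec (eigs_dec (A + B)))) (mset (rev (sort (list_of_vec x))))"
    by (intro averaging_if_list_majorized sorted_rev_sort)
  then show ?thesis by (simp add: x_def)
qed

lemma sum_fun_mset:
  assumes "dim_vec x = d"
  shows "sum_fun d f x = (\<Sum>y\<in>#mset (list_of_vec x). f y)"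
proof -
  have "sum_fun d f x = sum_list (map f (list_of_vec x))"
    using assms by (simp add: sum_fun_def list_of_vec_map sum_list_distinct_conv_sum_set o_def lessThan_atLeast0)
  also have "\<dots> = (\<Sum>y\<in>#mset (list_of_vec x). f y)"
    by (metis mset_map sum_mset_sum_list)
  finally show ?thesis .
qed

section \<open>Optimal completions\<close>

text \<open>
  Lidskii's inequality combined with that of Karamata. The equality case of the latter is the condition that defines
  \<open>completions_op\<close>.
\<close>

lemma convex_potential_lower_bound:
  assumes f: "strictly_convex_nonneg f"
    and F: "set F0 \<subseteq> carrier_vec d" and G: "set G \<subseteq> carrier_vec d"
  defines "x \<equiv> eigs_dec (frame_op d F0) + eigs_inc (frame_op d G)"
  shows "sum_fun d f x \<le> convex_potential d f (F0 @ G)"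
    and "convex_potential d f (F0 @ G) = sum_fun d f x \<longleftrightarrow> eigs_dec (frame_op d (F0 @ G)) = dec_rearr x"
proof -
  have FG: "set (F0 @ G) \<subseteq> carrier_vec d" using F G by simp
  define c where "c = eigs_dec (frame_op d (F0 @ G))"
  note herm = hermitian_frame_op[OF F] hermitian_frame_op[OF G] hermitian_frame_op[OF FG]
  have c: "dim_vec c = d" "dec_rearr c = c" "\<And>i. i < d \<Longrightarrow> 0 \<le> c $ i"
  proof -
    show dim: "dim_vec c = d" unfolding c_def by (rule hermitian_eigs_dec(2)[OF herm(3)])
    show "dec_rearr c = c"
      using hermitian_eigs_dec(3)[OF herm(3)] dim by (intro dec_rearr_id) (simp add: c_def)
    obtain w where "eigenbasis d (frame_op d (F0 @ G)) w (\<lambda>i. c $ i)"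
      using hermitian_eigs_dec(1)[OF herm(3)] by (auto simp: c_def)
    then show "0 \<le> c $ i" if "i < d" for i using eigenbasis_frame_op_nonneg FG that by blast
  qed
  have x: "dim_vec x = d"
    unfolding x_def by (simp add: eigs_inc_index[OF herm(2)])
  have avg: "averaging (mset (list_of_vec c)) (mset (list_of_vec x))"
    using spectrum_of_sum_averages_to_opposite_sum[OF herm(1,2)] frame_op_append[OF F G]
    by (simp add: c_def x_def)
  have "\<forall>y\<in>#mset (list_of_vec c). 0 \<le> y" using c by (auto simp: mem_list_of_vec)
  from averaging_strict_convex[OF avg f this]
  have cases: "mset (list_of_vec x) = mset (list_of_vec c) \<or> sum_fun d f x < sum_fun d f c"
    by (simp only: sum_fun_mset[OF x] sum_fun_mset[OF c(1)])
  have P: "convex_potential d f (F0 @ G) = sum_fun d f c" by (simp add: convex_potential_def c_def)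
  have eq: "sum_fun d f c = sum_fun d f x" if "mset (list_of_vec x) = mset (list_of_vec c)"
    by (simp only: sum_fun_mset[OF x] sum_fun_mset[OF c(1)] that)
  show "sum_fun d f x \<le> convex_potential d f (F0 @ G)" using cases eq P by fastforce
  have "c = dec_rearr x \<longleftrightarrow> mset (list_of_vec x) = mset (list_of_vec c)"
    using dec_rearr_eq_iff[of c x] c(2) by auto
  then show "convex_potential d f (F0 @ G) = sum_fun d f x \<longleftrightarrow> eigs_dec (frame_op d (F0 @ G)) = dec_rearr x"
    using cases eq P by (auto simp flip: c_def)
qed

lemma completions_iff:
  "F0 @ G \<in> completions d F0 a \<longleftrightarrow> set G \<subseteq> carrier_vec d \<and> map sq_norm G = list_of_vec a"
proof -
  have "map sq_norm G = list_of_vec a \<longleftrightarrow> length G = dim_vec a \<and> (\<forall>i<dim_vec a. sq_norm (G ! i) = a $ i)"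
    by (auto simp: list_eq_iff_nth_eq list_of_vec_index)
  then show ?thesis by (auto simp: completions_def)
qed

theorem theorem3p4:
  fixes d :: nat and F0 :: "complex vec list" and a :: "real vec"
    and l :: "real vec" and f :: "real \<Rightarrow> real"
  assumes "0 < d"
    and "initial_data d F0 a"
    and "l = eigs_dec (frame_op d F0)"
    and "\<forall>x\<ge>0. 0 \<le> f x"
    and "strictly_convex_nonneg f"
  shows "\<exists>\<mu> \<in> Gamma_set d a.
    (\<forall>G. F0 @ G \<in> completions d F0 a \<longrightarrow>
       (is_arg_min (convex_potential d f) (\<lambda>F. F \<in> completions d F0 a) (F0 @ G) \<longleftrightarrow>
        F0 @ G \<in> completions_op d F0 a \<and> eigs_inc (frame_op d G) = \<mu>)) \<and>
    (\<forall>\<mu>'. (\<mu>' \<in> Gamma_set d a \<and>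
           is_minimum_of (sum_fun d f (l + \<mu>')) ((\<lambda>\<gamma>. sum_fun d f (l + \<gamma>)) ` Gamma_set d a) \<and>
           is_minimum_of (sum_fun d f (l + \<mu>')) (sum_fun d f ` Lambda_op d a l)) \<longleftrightarrow> \<mu>' = \<mu>) \<and>
    (\<forall>i. i + 1 < d \<longrightarrow> 0 < \<mu> $ i \<longrightarrow> \<mu> $ i = \<mu> $ (i + 1) \<longrightarrow> l $ i = l $ (i + 1))"
proof -
  note f = assms(5)
  have F0: "set F0 \<subseteq> carrier_vec d" and a: "\<And>i. i < dim_vec a \<Longrightarrow> 0 < a $ i"
    and rank: "d - vec_space.rank d (frame_op d F0) \<le> dim_vec a"
    using assms(2) by (auto simp: initial_data_def)
  note herm = hermitian_frame_op[OF F0]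
  obtain u where u: "eigenbasis d (frame_op d F0) u (\<lambda>i. l $ i)"
    using hermitian_eigs_dec(1)[OF herm] assms(3) by blast
  have l_dim: "dim_vec l = d" unfolding assms(3) by (rule hermitian_eigs_dec(2)[OF herm])
  have l_dec: "l $ j \<le> l $ i" if "i \<le> j" "j < d" for i j
    unfolding assms(3) by (rule hermitian_eigs_dec(3)[OF herm that])
  have l_nonneg: "0 \<le> l $ i" if "i < d" for i by (rule eigenbasis_frame_op_nonneg[OF u F0 that])
  have zeros: "d - q \<le> dim_vec a" if "q < d" "l $ q = 0" for q
    using rank_le_if_eigenvalue_0[OF u F0 l_dec that] rank by linarith
  obtain \<mu>f where \<mu>f: "feasible d (dim_vec a) (top_sum a) \<mu>f"
    "\<And>\<gamma>. feasible d (dim_vec a) (top_sum a) \<gamma> \<Longrightarrow> shifted_sum d f (($) l) \<mu>f \<le> shifted_sum d f (($) l) \<gamma>"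
  proof (rule feasible_optimum[OF f _ l_nonneg l_dec])
    show "0 \<le> top_sum a 0" by simp
    show "top_sum a j < top_sum a (dim_vec a)" if "j < dim_vec a" for j
      using top_sum_less_total[OF a that] .
    show "feasible d (dim_vec a) (top_sum a) (\<lambda>i. if i = d - 1 then top_sum a (dim_vec a) else 0)"
      by (rule exists_feasible[OF a assms(1)])
  qed (use assms(4) zeros in auto)
  define \<mu> where "\<mu> = vec d \<mu>f"
  have \<mu>: "feasible d (dim_vec a) (top_sum a) (($) \<mu>)"
    using \<mu>f(1) by (simp add: \<mu>_def feasible_def)
  have \<mu>_Gamma: "\<mu> \<in> Gamma_set d a"
    using Gamma_set_iff_feasible[OF a] \<mu> by (simp add: \<mu>_def)
  have shift: "sum_fun d f (l + \<gamma>) = shifted_sum d f (($) l) (($) \<gamma>)" if "dim_vec \<gamma> = d" for \<gamma>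
    using that l_dim by (simp add: sum_fun_def shifted_sum_def)
  have Gamma_dim: "dim_vec \<gamma> = d" if "\<gamma> \<in> Gamma_set d a" for \<gamma> using that by (simp add: Gamma_set_def)
  have \<mu>_min: "shifted_sum d f (($) l) (($) \<mu>) \<le> shifted_sum d f (($) l) \<gamma>"
    if "feasible d (dim_vec a) (top_sum a) \<gamma>" for \<gamma>
    using \<mu>f(2)[OF that] by (simp add: shifted_sum_def \<mu>_def)
  have min: "sum_fun d f (l + \<mu>) \<le> sum_fun d f (l + \<gamma>)" if "\<gamma> \<in> Gamma_set d a" for \<gamma>
    using \<mu>_min that Gamma_set_iff_feasible[OF a] shift Gamma_dim \<mu>_Gamma by metis
  have uniq: "\<gamma> = \<mu>" if "\<gamma> \<in> Gamma_set d a" "sum_fun d f (l + \<gamma>) \<le> sum_fun d f (l + \<mu>)" for \<gamma>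
  proof (intro eq_vecI)
    show "dim_vec \<gamma> = dim_vec \<mu>" using Gamma_dim that(1) \<mu>_Gamma by simp
    fix i assume "i < dim_vec \<mu>"
    then have i: "i < d" using Gamma_dim \<mu>_Gamma by simp
    have "feasible d (dim_vec a) (top_sum a) (($) \<gamma>)" using Gamma_set_iff_feasible[OF a] that(1) by blast
    moreover have "shifted_sum d f (($) l) (($) \<gamma>) \<le> shifted_sum d f (($) l) (($) \<mu>)"
      using that shift Gamma_dim \<mu>_Gamma by metis
    ultimately show "\<gamma> $ i = \<mu> $ i"
      using feasible_minimizer_unique[where l = "($) l" and \<mu> = "($) \<mu>" and \<gamma> = "($) \<gamma>",
          OF f l_nonneg \<mu> \<mu>_min _ _ i] by blast
  qed
  \<comment> \<open>A completion that is diagonal in an eigenbasis of the given frame attains the lower bound.\<close>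
  obtain H where H: "set H \<subseteq> carrier_vec d" "map sq_norm H = list_of_vec a"
    "eigenbasis d (frame_op d H) u (\<lambda>i. \<mu> $ i)"
    using exists_frame_with_spectrum[OF a \<mu>_Gamma u] by blast
  have H_compl: "F0 @ H \<in> completions d F0 a" using H by (simp add: completions_iff)
  have H_pot: "convex_potential d f (F0 @ H) = sum_fun d f (l + \<mu>)"
  proof -
    have "eigenbasis d (frame_op d (F0 @ H)) u (\<lambda>i. l $ i + \<mu> $ i)"
      unfolding frame_op_append[OF F0 H(1)] by (rule eigenbasis_add[OF u H(3)])
    then have "eigs_dec (frame_op d (F0 @ H)) = dec_rearr (vec d (\<lambda>i. l $ i + \<mu> $ i))"
      by (rule eigs_dec_eigenbasis)
    also have "vec d (\<lambda>i. l $ i + \<mu> $ i) = l + \<mu>"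
      using l_dim Gamma_dim[OF \<mu>_Gamma] by (intro eq_vecI) auto
    finally show ?thesis
      using sum_fun_dec_rearr[of "l + \<mu>" d f] Gamma_dim[OF \<mu>_Gamma] by (simp add: convex_potential_def)
  qed
  have potential: "sum_fun d f (l + \<mu>) \<le> convex_potential d f (F0 @ G)"
    "convex_potential d f (F0 @ G) = sum_fun d f (l + \<mu>) \<longleftrightarrow>
      F0 @ G \<in> completions_op d F0 a \<and> eigs_inc (frame_op d G) = \<mu>"
    if G_compl: "F0 @ G \<in> completions d F0 a" for G
  proof -
    define \<nu> where "\<nu> = eigs_inc (frame_op d G)"
    have G: "set G \<subseteq> carrier_vec d" "map sq_norm G = list_of_vec a"
      using G_compl by (simp_all add: completions_iff)
    have \<nu>: "\<nu> \<in> Gamma_set d a" unfolding \<nu>_def by (rule spectrum_in_Gamma_set[OF G a])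
    have low: "sum_fun d f (l + \<nu>) \<le> convex_potential d f (F0 @ G)"
      "convex_potential d f (F0 @ G) = sum_fun d f (l + \<nu>) \<longleftrightarrow>
        eigs_dec (frame_op d (F0 @ G)) = dec_rearr (l + \<nu>)"
      unfolding \<nu>_def assms(3)
      by (rule convex_potential_lower_bound(1)[OF f F0 G(1)], rule convex_potential_lower_bound(2)[OF f F0 G(1)])
    have op: "F0 @ G \<in> completions_op d F0 a \<longleftrightarrow> eigs_dec (frame_op d (F0 @ G)) = dec_rearr (l + \<nu>)"
      using G_compl by (auto simp: completions_op_def \<nu>_def assms(3))
    show "sum_fun d f (l + \<mu>) \<le> convex_potential d f (F0 @ G)" using low(1) min[OF \<nu>] by simp
    show "convex_potential d f (F0 @ G) = sum_fun d f (l + \<mu>) \<longleftrightarrow>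
      F0 @ G \<in> completions_op d F0 a \<and> eigs_inc (frame_op d G) = \<mu>"
      unfolding op \<nu>_def[symmetric] using low min[OF \<nu>] uniq[OF \<nu>] by fastforce
  qed
  have part1: "is_arg_min (convex_potential d f) (\<lambda>F. F \<in> completions d F0 a) (F0 @ G) \<longleftrightarrow>
        F0 @ G \<in> completions_op d F0 a \<and> eigs_inc (frame_op d G) = \<mu>"
    if G_compl: "F0 @ G \<in> completions d F0 a" for G
  proof -
    have all: "sum_fun d f (l + \<mu>) \<le> convex_potential d f F" if F: "F \<in> completions d F0 a" for F
    proof -
      obtain G' where "F = F0 @ G'" using F unfolding completions_def by blast
      then show ?thesis using potential(1)[of G'] F by simp
    qed
    have "is_arg_min (convex_potential d f) (\<lambda>F. F \<in> completions d F0 a) (F0 @ G) \<longleftrightarrow>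
        convex_potential d f (F0 @ G) = sum_fun d f (l + \<mu>)"
      unfolding is_arg_min_def using all G_compl H_compl H_pot by (metis antisym_conv2 less_irrefl not_less)
    then show ?thesis using potential(2)[OF G_compl] by simp
  qed
  have "dec_rearr l = l" using l_dec l_dim by (intro dec_rearr_id) simp
  then have images: "sum_fun d f ` Lambda_op d a l = (\<lambda>\<gamma>. sum_fun d f (l + \<gamma>)) ` Gamma_set d a"
    by (auto simp: Lambda_op_def)
  have part2: "(\<mu>' \<in> Gamma_set d a \<and>
           is_minimum_of (sum_fun d f (l + \<mu>')) ((\<lambda>\<gamma>. sum_fun d f (l + \<gamma>)) ` Gamma_set d a) \<and>
           is_minimum_of (sum_fun d f (l + \<mu>')) (sum_fun d f ` Lambda_op d a l)) \<longleftrightarrow> \<mu>' = \<mu>" for \<mu>'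
    unfolding images is_minimum_of_def using \<mu>_Gamma min uniq by auto
  have part3: "l $ i = l $ (i + 1)" if "i + 1 < d" "0 < \<mu> $ i" "\<mu> $ i = \<mu> $ (i + 1)" for i
    by (rule minimizer_blocks[where l = "($) l" and \<mu> = "($) \<mu>", OF f l_nonneg l_dec \<mu> \<mu>_min that])
  show ?thesis using \<mu>_Gamma part1 part2 part3 by (intro bexI[of _ \<mu>]) blast+
qed

end
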